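(* Let $N\ge 2$ and $m>N$ be integers. For every $t\in(\mathbb Z/m\mathbb Z)^\times$, the automorphism $\sigma_t:\zeta_m\mapsto\zeta_m^t$ of $\mathbb Q(\zeta_m)$, acting on $\mathbb Z/m\mathbb Z$ through multiplication by $t$, permutes the $N$-element subsets of $\mathbb Z/m\mathbb Z$ containing $0$ and hence induces a permutation of $\mathcal A(m,N)$. Write $\sigma_t\cdot x$ for the unique point of $\mathcal A(m,N)$ whose underlying set is $\{tx_a \bmod m: 0\le a\le N-1\}$. Then $r_{\sigma_t\cdot x}=\sigma_t(r_x)$ for every $x\in\mathcal A(m,N)$. Consequently $D_N(w)\in\mathbb Z[w]$, every root of $D_N$ lies in $\mathbb Q(\zeta_m)^+$, and every irreducible factor of $D_N$ over $\mathbb Q$ has degree dividing $\varphi(m)/2$.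
   Context: $\zeta_m=e^{2\pi i/m}$; $\mathbb Q(\zeta_m)^+$ is the maximal real subfield of $\mathbb Q(\zeta_m)$; $\varphi$ is Euler's totient function. $\mathcal A(m,N):=\{x=(x_1,\dots,x_{N-1})\in\mathbb Z^{N-1}: 0<x_1<\cdots<x_{N-1}<m\}$, with the convention $x_0:=0$; the underlying set of $x\in\mathcal A(m,N)$ is the $N$-element subset $\{0,x_1,\dots,x_{N-1}\}$ of $\mathbb Z/m\mathbb Z$. For $x\in\mathcal A(m,N)$, $$r_x:=\prod_{0\le a<b\le N-1}\big|e^{2\pi i x_a/m}-e^{2\pi i x_b/m}\big|^2=\prod_{0\le a<b\le N-1}4\sin^2\frac{\pi(x_b-x_a)}{m},$$ and $D_N(w):=\prod_{x\in\mathcal A(m,N)}(w-r_x)$. *)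

theory Defs
  imports
    "HOL-Analysis.Analysis"
    "HOL-Number_Theory.Residues"
    "HOL-Algebra.Generated_Fields"
    "HOL-Algebra.QuotRing"
    "HOL-Algebra.Algebraic_Closure_Type"
begin

definition zeta :: "nat \<Rightarrow> complex" where
  "zeta m = exp (2 * of_real pi * \<i> / of_nat m)"

text \<open>\<open>ring_of_type_algebra\<close> is the type \<open>complex\<close> viewed as an HOL-Algebra ring. A generated
  subfield contains 1, hence the rationals, so this is the field of rational expressions in
  \<open>zeta m\<close>.\<close>

definition cyclo :: "nat \<Rightarrow> complex set" where
  "cyclo m = generate_field ring_of_type_algebra {zeta m}"

definition cyclo_ring :: "nat \<Rightarrow> complex ring" where
  "cyclo_ring m = ring_of_type_algebra\<lparr>carrier := cyclo m\<rparr>"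

text \<open>The maximal real subfield; see \<open>cyclo_real_maximal\<close> below.\<close>

definition cyclo_real :: "nat \<Rightarrow> complex set" where
  "cyclo_real m = cyclo m \<inter> \<real>"

text \<open>An automorphism of the field \<open>cyclo m\<close> is made unique as a HOL function by requiring it to be
  \<open>undefined\<close> outside \<open>cyclo m\<close>.\<close>

definition is_cyclo_aut :: "nat \<Rightarrow> int \<Rightarrow> (complex \<Rightarrow> complex) \<Rightarrow> bool" where
  "is_cyclo_aut m t s \<longleftrightarrow>
     s \<in> ring_iso (cyclo_ring m) (cyclo_ring m) \<and> s \<in> extensional (cyclo m) \<and>
     s (zeta m) = zeta m powi t"

definition cyclo_aut :: "nat \<Rightarrow> int \<Rightarrow> complex \<Rightarrow> complex" where
  "cyclo_aut m t = (THE s. is_cyclo_aut m t s)"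

text \<open>A point \<open>(x\<^sub>1, \<dots>, x\<^bsub>N-1\<^esub>)\<close> is the list \<open>x\<close> of its coordinates, so \<open>0 # x\<close> is the list
  \<open>(x\<^sub>0, \<dots>, x\<^bsub>N-1\<^esub>)\<close> with the convention \<open>x\<^sub>0 = 0\<close>.\<close>

definition points :: "nat \<Rightarrow> nat \<Rightarrow> int list set" where
  "points m N = {x. length x = N - 1 \<and> sorted_wrt (<) (0 # x @ [int m])}"

definition underlying :: "int list \<Rightarrow> int set" where
  "underlying x = set (0 # x)"

text \<open>\<open>\<int>/m\<int>\<close> is \<open>residue_ring (int m)\<close>, with carrier \<open>{0..int m - 1}\<close> and multiplication mod \<open>m\<close>.\<close>

definition zero_subsets :: "nat \<Rightarrow> nat \<Rightarrow> int set set" where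
  "zero_subsets m N = {S. S \<subseteq> carrier (residue_ring (int m)) \<and> card S = N \<and> 0 \<in> S}"

definition mult_set :: "nat \<Rightarrow> int \<Rightarrow> int set \<Rightarrow> int set" where
  "mult_set m t S = (\<lambda>s. t \<otimes>\<^bsub>residue_ring (int m)\<^esub> s) ` S"

definition act :: "nat \<Rightarrow> nat \<Rightarrow> int \<Rightarrow> int list \<Rightarrow> int list" where
  "act m N t x = (THE y. y \<in> points m N \<and> underlying y = mult_set m t (underlying x))"

definition r :: "nat \<Rightarrow> nat \<Rightarrow> int list \<Rightarrow> real" where
  "r m N x = (\<Prod>(a, b)\<in>{(a, b). a < b \<and> b \<le> N - 1}.
     (cmod (exp (2 * of_real pi * \<i> * of_int ((0 # x) ! a) / of_nat m) -
            exp (2 * of_real pi * \<i> * of_int ((0 # x) ! b) / of_nat m)))\<^sup>2)"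

definition D :: "nat \<Rightarrow> nat \<Rightarrow> complex poly" where
  "D m N = (\<Prod>x\<in>points m N. [:- of_real (r m N x), 1:])"


lemma ring_simps [simp]:
  "carrier (ring_of_type_algebra :: complex ring) = UNIV"
  "a \<oplus>\<^bsub>ring_of_type_algebra\<^esub> b = (a + b :: complex)"
  "a \<otimes>\<^bsub>ring_of_type_algebra\<^esub> b = (a * b :: complex)"
  "\<zero>\<^bsub>ring_of_type_algebra\<^esub> = (0 :: complex)"
  "\<one>\<^bsub>ring_of_type_algebra\<^esub> = (1 :: complex)"
  by (simp_all add: ring_of_type_algebra_def)

lemma ring_a_inv [simp]: "\<ominus>\<^bsub>ring_of_type_algebra\<^esub> a = (- a :: complex)"
proof -
  interpret field "ring_of_type_algebra :: complex ring" by rule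
  show ?thesis by (rule minus_equality) auto
qed

lemma ring_m_inv [simp]:
  assumes "a \<noteq> 0"
  shows "inv\<^bsub>ring_of_type_algebra\<^esub> a = (inverse a :: complex)"
proof -
  interpret field "ring_of_type_algebra :: complex ring" by rule
  show ?thesis by (rule comm_inv_char) (use assms in auto)
qed

lemma cyclo_real_maximal:
  "subfield (cyclo_real m) ring_of_type_algebra"
  "cyclo_real m \<subseteq> cyclo m \<inter> \<real>"
  "\<And>F. \<lbrakk>subfield F ring_of_type_algebra; F \<subseteq> cyclo m; F \<subseteq> \<real>\<rbrakk> \<Longrightarrow> F \<subseteq> cyclo_real m"
proof -
  interpret field "ring_of_type_algebra :: complex ring" by rule
  have K: "subfield (cyclo m) ring_of_type_algebra"
    unfolding cyclo_def by (rule generate_field_is_subfield) simp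
  note K' = subringE[OF subfieldE(1)[OF K]]
  show "subfield (cyclo_real m) ring_of_type_algebra"
  proof (rule subfieldI')
    show "subring (cyclo_real m) ring_of_type_algebra"
      by (rule subringI) (use K' in \<open>auto simp: cyclo_real_def\<close>)
    fix k assume "k \<in> cyclo_real m - {\<zero>\<^bsub>ring_of_type_algebra\<^esub>}"
    then show "inv\<^bsub>ring_of_type_algebra\<^esub> k \<in> cyclo_real m"
      using subfield_m_inv(1)[OF K, of k] by (auto simp: cyclo_real_def)
  qed
qed (auto simp: cyclo_real_def)

lemma r_sin:
  "r m N x = (\<Prod>(a, b)\<in>{(a, b). a < b \<and> b \<le> N - 1}.
     4 * (sin (pi * of_int ((0 # x) ! b - (0 # x) ! a) / of_nat m))\<^sup>2)"
proof -
  have "(cmod (exp (2 * of_real pi * \<i> * of_int u / of_nat m) -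
            exp (2 * of_real pi * \<i> * of_int v / of_nat m)))\<^sup>2
       = 4 * (sin (pi * of_int (v - u) / of_nat m))\<^sup>2" for u v :: int
  proof -
    define p q :: real where "p = 2 * pi * u / m" and "q = 2 * pi * v / m"
    have e: "exp (2 * of_real pi * \<i> * of_int u / of_nat m) = cis p"
            "exp (2 * of_real pi * \<i> * of_int v / of_nat m) = cis q"
      by (simp_all add: cis_conv_exp p_def q_def mult_ac)
    have h: "pi * of_int (v - u) / of_nat m = (q - p) / 2"
      by (simp add: p_def q_def algebra_simps diff_divide_distrib)
    have "(cmod (cis p - cis q))\<^sup>2 = (cos p - cos q)\<^sup>2 + (sin p - sin q)\<^sup>2"
      by (simp add: cmod_power2)
    also have "\<dots> = ((sin p)\<^sup>2 + (cos p)\<^sup>2) + ((sin q)\<^sup>2 + (cos q)\<^sup>2) - 2 * cos (q - p)"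
      unfolding cos_diff by (simp add: power2_eq_square algebra_simps del: sin_cos_squared_add sin_cos_squared_add2)
    also have "\<dots> = 2 - 2 * cos (2 * ((q - p) / 2))" by simp
    also have "\<dots> = 4 * (sin ((q - p) / 2))\<^sup>2"
      by (subst cos_double_sin) simp
    finally show ?thesis unfolding e h .
  qed
  then show ?thesis unfolding r_def by (simp only:)
qed

end

theory Submission
  imports Defs
begin

hide_const (open) Module.smult Divisibility.prime Polynomials.lead_coeff Polynomials.degree Divisibility.irreducible

text \<open>
  If \<open>g\<close> is an integer polynomial, \<open>\<omega>\<^sup>m = 1\<close>, \<open>g(\<omega>) = 0\<close> and \<open>p\<close> is a prime not dividing \<open>m\<close>,
  then \<open>g(\<omega>\<^sup>p) = 0\<close>: write \<open>X\<^sup>m - 1 = f h\<close> with \<open>f\<close> the minimal polynomial of \<open>\<omega>\<close>. If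
  \<open>f(\<omega>\<^sup>p) \<noteq> 0\<close>, then \<open>h(\<omega>\<^sup>p) = 0\<close>, so differentiating at \<open>\<omega>\<^sup>p\<close> shows that \<open>f(\<omega>\<^sup>p)\<close> divides \<open>m\<close> in
  \<open>\<int>[\<omega>]\<close>; but \<open>f(\<omega>\<^sup>p) \<equiv> f(\<omega>)\<^sup>p = 0\<close> modulo \<open>p\<close>, so \<open>p\<close> divides \<open>m\<close>. This gives the automorphisms
  \<open>\<sigma>\<^sub>t\<close>, and it follows that \<open>g(\<zeta>)\<close> is an integer whenever \<open>g(\<zeta>\<^sup>t) = g(\<zeta>)\<close> for all \<open>t\<close> coprime to \<open>m\<close>.

  For a point with underlying set \<open>S\<close> one has
  \<open>r = \<Prod> (1 - \<zeta>\<^bsup>v-u\<^esup>)\<close> over the ordered pairs \<open>u \<noteq> v\<close> in \<open>S\<close>. Hence \<open>\<sigma>\<^sub>t\<close> maps this to the product for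
  \<open>t S\<close>, and the coefficients of \<open>D\<close> are invariant. The conjugates of \<open>r\<close> form an orbit, which is the set
  of roots of the irreducible factor vanishing at \<open>r\<close>; all fibres of \<open>t \<mapsto> \<sigma>\<^sub>t(r)\<close> have the same cardinality,
  which is even because \<open>\<sigma>\<^bsub>-1\<^esub>\<close> fixes the conjugates and \<open>t \<noteq> -t\<close> for \<open>m > 2\<close>.
\<close>

section \<open>Evaluation of integer polynomials\<close>

text \<open>Casts, coefficientwise maps of polynomials and evaluation at a point are all instances,
  so the transfer of sums, products and powers is proved once for the three of them.\<close>

locale unital_ring_hom =
  fixes h :: "'a::comm_ring_1 \<Rightarrow> 'b::comm_ring_1"
  assumes hom_one: "h 1 = 1"
    and hom_add: "h (x + y) = h x + h y"
    and hom_mult: "h (x * y) = h x * h y"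
begin

lemma hom_zero: "h 0 = 0"
  using hom_add[of 0 0] by simp

lemma hom_uminus: "h (- x) = - h x"
  using hom_add[of x "- x"] by (simp add: hom_zero eq_neg_iff_add_eq_0 add.commute)

lemma hom_diff: "h (x - y) = h x - h y"
  using hom_add[of x "- y"] by (simp add: hom_uminus)

lemma hom_sum: "h (sum f A) = (\<Sum>a\<in>A. h (f a))"
  by (induction A rule: infinite_finite_induct) (auto simp: hom_zero hom_add)

lemma hom_prod: "h (prod f A) = (\<Prod>a\<in>A. h (f a))"
  by (induction A rule: infinite_finite_induct) (auto simp: hom_one hom_mult)

lemma hom_power: "h (x ^ n) = h x ^ n"
  by (induction n) (auto simp: hom_one hom_mult)

lemma unital_ring_hom_map_poly: "unital_ring_hom (map_poly h)"
proof
  show "map_poly h 1 = 1" by (simp add: hom_one)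
  fix p q
  show "map_poly h (p + q) = map_poly h p + map_poly h q"
    by (intro poly_eqI) (simp add: coeff_map_poly hom_zero hom_add)
  show "map_poly h (p * q) = map_poly h p * map_poly h q"
    by (intro poly_eqI) (simp add: coeff_map_poly hom_zero coeff_mult hom_sum hom_mult)
qed

end

interpretation of_int_hom: unital_ring_hom "of_int :: int \<Rightarrow> 'a::comm_ring_1"
  by standard auto

interpretation of_int_poly_hom: unital_ring_hom "map_poly of_int :: int poly \<Rightarrow> 'a::comm_ring_1 poly"
  by (rule of_int_hom.unital_ring_hom_map_poly)

interpretation of_rat_hom: unital_ring_hom "of_rat :: rat \<Rightarrow> 'a::field_char_0"
  by standard (auto simp: of_rat_add of_rat_mult)

interpretation of_rat_poly_hom: unital_ring_hom "map_poly of_rat :: rat poly \<Rightarrow> 'a::field_char_0 poly"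
  by (rule of_rat_hom.unital_ring_hom_map_poly)

text \<open>Elements of the ring generated by \<open>zeta m\<close> are handled through integer
  polynomials: conjugating such an element then just means changing the evaluation point.\<close>

definition ipoly :: "int poly \<Rightarrow> 'a::comm_ring_1 \<Rightarrow> 'a" where
  "ipoly g z = poly (map_poly of_int g) z"

interpretation ipoly_hom: unital_ring_hom "\<lambda>g. ipoly g (z::'a::comm_ring_1)"
  by standard (auto simp: ipoly_def of_int_poly_hom.hom_add of_int_poly_hom.hom_mult)

lemmas ipoly_simps = ipoly_hom.hom_zero ipoly_hom.hom_one ipoly_hom.hom_add ipoly_hom.hom_mult
  ipoly_hom.hom_uminus ipoly_hom.hom_diff ipoly_hom.hom_prod ipoly_hom.hom_power

lemma ipoly_pCons: "ipoly (pCons a g) z = of_int a + z * ipoly g z"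
  by (simp add: ipoly_def map_poly_pCons)

lemma ipoly_monom: "ipoly (Polynomial.monom 1 k) z = z ^ k"
  by (simp add: ipoly_def map_poly_monom poly_monom)

lemma ipoly_smult: "ipoly (smult c g) z = of_int c * ipoly g z"
  by (simp add: ipoly_def map_poly_smult)

lemma ipoly_pcompose: "ipoly (g \<circ>\<^sub>p f) z = ipoly g (ipoly f z)"
  by (induction g) (auto simp: pcompose_pCons ipoly_pCons ipoly_simps)

lemma ipoly_dvd_0: "f dvd g \<Longrightarrow> ipoly f z = 0 \<Longrightarrow> ipoly g z = 0"
  by (auto simp: ipoly_simps elim!: dvdE)

text \<open>The value of this polynomial at \<open>zeta m\<close> is the value of \<open>g\<close>
  at the \<open>k\<close>-th power, so a conjugate is again an integer polynomial in
  \<open>zeta m\<close> itself.\<close>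

abbreviation subst_power :: "int poly \<Rightarrow> nat \<Rightarrow> int poly" where
  "subst_power g k \<equiv> g \<circ>\<^sub>p Polynomial.monom 1 k"

lemma ipoly_subst_power: "ipoly (subst_power g k) z = ipoly g (z ^ k)"
  by (simp add: ipoly_pcompose ipoly_monom)

section \<open>The Frobenius map modulo a prime\<close>

lemma prime_dvd_add_power:
  fixes x y :: "'a::comm_ring_1"
  assumes "prime p"
  shows "of_nat p dvd (x + y) ^ p - (x ^ p + y ^ p)"
proof -
  have p: "p > 1" using assms prime_gt_1_nat by blast
  have "(x + y) ^ p = (\<Sum>k\<le>p. of_nat (p choose k) * x ^ k * y ^ (p - k))"
    by (rule binomial_ring)
  also have "{..p} = insert 0 (insert p {1..<p})" using p by auto
  also have "(\<Sum>k\<in>\<dots>. of_nat (p choose k) * x ^ k * y ^ (p - k))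
      = y ^ p + (x ^ p + (\<Sum>k\<in>{1..<p}. of_nat (p choose k) * x ^ k * y ^ (p - k)))"
    using p by simp
  finally have "(x + y) ^ p - (x ^ p + y ^ p) = (\<Sum>k\<in>{1..<p}. of_nat (p choose k) * x ^ k * y ^ (p - k))"
    by simp
  also have "of_nat p dvd \<dots>"
  proof (rule dvd_sum)
    fix k assume "k \<in> {1..<p}"
    then have "p dvd (p choose k)" by (intro dvd_choose_prime) (use assms in auto)
    then show "of_nat p dvd of_nat (p choose k) * x ^ k * y ^ (p - k)"
      by (auto simp: dvd_def mult.assoc)
  qed
  finally show ?thesis .
qed

text \<open>Modulo \<open>p\<close> the Frobenius map is additive and, by Fermat, fixes integer
  constants; induction on the coefficients extends this to \<open>g\<close>.\<close>

lemma prime_dvd_power_minus_subst_power: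
  assumes "prime p"
  shows "of_nat p dvd g ^ p - subst_power g p"
proof (induction g)
  case 0
  then show ?case using assms by (simp add: prime_gt_0_nat zero_power)
next
  case (pCons a g)
  have a: "of_nat p dvd ([:a:] ^ p - [:a:] :: int poly)"
  proof -
    have "[a ^ p = a] (mod int p)"
    proof (cases "int p dvd a")
      case True
      then show ?thesis using assms
        by (metis cong_0_iff cong_sym cong_trans dvd_power prime_gt_0_nat dvd_trans)
    next
      case False
      \<comment> \<open>Fermat's theorem is applied to a natural number \<open>b\<close> in the
        residue class of \<open>a\<close>.\<close>
      obtain b where b: "[a = int b] (mod int p)"
        by (metis assms cong_mod_right cong_refl nat_0_le pos_mod_sign prime_gt_0_int prime_nat_int_transfer)
      have "\<not> p dvd b" using False b
        by (metis cong_dvd_iff int_dvd_int_iff)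
      then have "[b ^ (p - 1) = 1] (mod p)" by (rule fermat_theorem[OF assms])
      then have "[b ^ (p - 1) * b = 1 * b] (mod p)" by (intro cong_mult) auto
      then have "[b ^ p = b] (mod p)" using assms prime_gt_0_nat[of p]
        by (simp flip: power_Suc2)
      then have "[int b ^ p = int b] (mod int p)" by (metis cong_int_iff of_nat_power)
      then show ?thesis using b by (metis cong_pow cong_sym cong_trans)
    qed
    then have "int p dvd a ^ p - a" by (simp add: cong_iff_dvd_diff)
    then have "[:int p:] dvd [:a ^ p - a:]" by (auto simp: dvd_def intro: exI[of _ "[:_:]"])
    then show ?thesis by (simp add: of_nat_poly poly_const_pow)
  qed
  define Y :: "int poly" where "Y = Polynomial.monom 1 1"
  have g: "pCons a g = [:a:] + Y * g" by (simp add: Y_def monom_altdef)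
  have Y: "subst_power (pCons a g) p = [:a:] + Y ^ p * subst_power g p"
    by (simp add: pcompose_pCons Y_def monom_power)
  \<comment> \<open>The three summands are the error of additivity, the Fermat error of the
    constant, and a multiple of the induction hypothesis.\<close>
  have "pCons a g ^ p - subst_power (pCons a g) p =
     (([:a:] + Y * g) ^ p - ([:a:] ^ p + (Y * g) ^ p)) + ([:a:] ^ p - [:a:]) + Y ^ p * (g ^ p - subst_power g p)"
    unfolding Y unfolding g by (simp add: power_mult_distrib algebra_simps)
  then show ?case
    using prime_dvd_add_power[OF assms, of "[:a:]" "Y * g"] a pCons.IH
    by (metis dvd_add dvd_mult)
qed

section \<open>Division by monic polynomials and minimal polynomials of roots of unity\<close>

lemma monic_div_mod:
  fixes f g :: "'a::{comm_ring_1,semiring_1_no_zero_divisors} poly"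
  assumes "lead_coeff f = 1"
  obtains q s where "g = f * q + s" "s = 0 \<or> Polynomial.degree s < Polynomial.degree f"
proof -
  \<comment> \<open>Pseudo-division scales \<open>g\<close> by a power of the leading coefficient of
    \<open>f\<close>, which is 1 here.\<close>
  obtain q s where "pseudo_divmod g f = (q, s)" by fastforce
  moreover have "f \<noteq> 0" using assms by auto
  ultimately have "g = f * q + s" "s = 0 \<or> Polynomial.degree s < Polynomial.degree f"
    using pseudo_divmod[of f g q s] assms by auto
  then show ?thesis using that by blast
qed

lemma ipoly_unity: "ipoly (Polynomial.monom 1 m - 1) z = z ^ m - 1"
  by (simp add: ipoly_simps ipoly_monom)

text \<open>A nonzero integer polynomial of least degree vanishing at \<open>w\<close> is made
  primitive. By Gauss's lemma it then divides every such polynomial over the integers, and dividing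
  the monic \<open>X^m - 1\<close> forces its leading coefficient to be 1 or -1.\<close>

lemma root_of_unity_minpoly:
  fixes w :: complex
  assumes "w ^ m = 1" "m > 0"
  obtains f where "lead_coeff f = 1" "\<And>g. ipoly g w = 0 \<longleftrightarrow> f dvd g" "Polynomial.degree f > 0"
proof -
  define u where "u = (Polynomial.monom 1 m - 1 :: int poly)"
  have u0: "ipoly u w = 0" unfolding u_def ipoly_unity using assms by simp
  have lu: "lead_coeff u = 1"
  proof -
    have "Polynomial.coeff u m = 1" using assms(2) by (simp add: u_def)
    moreover have "Polynomial.degree u \<le> m"
      unfolding u_def by (intro degree_diff_le) (auto simp: degree_monom_le)
    ultimately show ?thesis
      by (metis le_antisym le_degree zero_neq_one)
  qed
  then have "u \<noteq> 0" by auto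
  define Z where "Z = (\<lambda>g. g \<noteq> 0 \<and> ipoly g w = 0)"
  obtain f0 where f0: "Z f0" and min: "\<And>g. Z g \<Longrightarrow> Polynomial.degree f0 \<le> Polynomial.degree g"
    using ex_has_least_nat[of Z u Polynomial.degree] \<open>u \<noteq> 0\<close> u0 Z_def by auto
  define f where "f = primitive_part f0"
  have fne: "f \<noteq> 0" using f0 by (simp add: f_def Z_def)
  have "of_int (content f0) * ipoly f w = 0"
    using f0 unfolding f_def Z_def by (metis content_times_primitive_part ipoly_smult)
  then have fw: "ipoly f w = 0" using f0 by (auto simp: Z_def)
  have deg: "Polynomial.degree f = Polynomial.degree f0" by (simp add: f_def)
  have dvd: "f dvd g" if g: "ipoly g w = 0" for g
  proof -
    obtain q s where qs: "pseudo_divmod g f = (q, s)" by fastforce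
    define c where "c = lead_coeff f ^ (Suc (Polynomial.degree g) - Polynomial.degree f)"
    have c: "c \<noteq> 0" using fne by (simp add: c_def)
    have e: "smult c g = f * q + s" "s = 0 \<or> Polynomial.degree s < Polynomial.degree f"
      using pseudo_divmod[OF fne qs] by (auto simp: c_def)
    have "ipoly (smult c g) w = ipoly (f * q + s) w" using e(1) by simp
    then have "ipoly s w = 0" using g fw by (simp add: ipoly_smult ipoly_simps)
    then have "s = 0" using e(2) min[of s] deg unfolding Z_def by linarith
    then have e': "smult c g = f * q" using e by simp
    \<comment> \<open>Since \<open>f\<close> is primitive, the scaling factor \<open>c\<close> left
      by pseudo-division must divide the content of \<open>q\<close> and can be cancelled.\<close>
    have cf: "content f = 1" using f0 by (simp add: f_def Z_def)
    have "content (f * q) = content q" by (simp add: content_mult cf)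
    moreover have "content (smult c g) = normalize c * content g" by simp
    ultimately have "\<bar>c\<bar> * content g = content q" unfolding e' by simp
    then have "c dvd content q" by (metis abs_dvd_iff dvd_triv_left)
    then have "[:c:] dvd q" by (simp add: const_poly_dvd_iff_dvd_content)
    then obtain q' where "q = smult c q'" by (auto simp: dvd_def)
    then have "smult c g = smult c (f * q')" using e' by simp
    then have "g = f * q'" using c by (metis smult_cancel)
    then show ?thesis by simp
  qed
  have "lead_coeff f dvd 1"
    using dvd[OF u0] lu by (metis dvd_def lead_coeff_mult)
  then have l: "lead_coeff f = 1 \<or> lead_coeff f = -1" by (auto simp: zdvd1_eq)
  define f' where "f' = smult (lead_coeff f) f"
  have 1: "lead_coeff f' = 1" using l by (auto simp: f'_def)
  have 2: "ipoly g w = 0 \<longleftrightarrow> f' dvd g" for g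
    using dvd[of g] ipoly_dvd_0[of f' g w] fw l by (auto simp: f'_def ipoly_simps)
  have 3: "Polynomial.degree f' > 0"
  proof (rule ccontr)
    assume "\<not> ?thesis"
    then obtain c where "f' = [:c:]" by (auto elim: degree_eq_zeroE)
    then have "f' = 1" using 1 by (simp add: one_pCons)
    then show False using 2[of 1] by (simp add: ipoly_simps)
  qed
  from that[OF 1 2 3] show ?thesis .
qed

section \<open>Irreducibility of the cyclotomic polynomial\<close>

lemma ipoly_root_prime_power:
  fixes w :: complex
  assumes w: "w ^ m = 1" and m: "m > 0" and p: "prime p" and pm: "\<not> p dvd m" and g: "ipoly g w = 0"
  shows "ipoly g (w ^ p) = 0"
proof -
  obtain f where lf: "lead_coeff f = 1" and f: "\<And>g. ipoly g w = 0 \<longleftrightarrow> f dvd g"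
    and df: "Polynomial.degree f > 0"
    by (rule root_of_unity_minpoly[OF w m]) blast
  define u where "u = (Polynomial.monom 1 m - 1 :: int poly)"
  have "f dvd u" using w by (simp add: f[symmetric] u_def ipoly_unity)
  then obtain h where u: "u = f * h" by (auto elim: dvdE)
  define y where "y = w ^ p"
  have y: "y ^ m = 1" using w unfolding y_def by (metis power_mult mult.commute power_one)
  have "ipoly f y = 0"
  proof (rule ccontr)
    assume nz: "ipoly f y \<noteq> 0"
    have "ipoly f y * ipoly h y = 0"
      using y by (metis u u_def ipoly_unity ipoly_simps(4) diff_self)
    then have h: "ipoly h y = 0" using nz by simp
    obtain k where k: "f ^ p - subst_power f p = of_nat p * k"
      using prime_dvd_power_minus_subst_power[OF p, of f] by (auto elim: dvdE)
    have fw: "ipoly f w = 0" using f by auto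
    have of_nat_ev: "ipoly (of_nat n) z = of_nat n" for n and z :: complex
      by (simp add: of_nat_poly ipoly_pCons ipoly_simps)
    \<comment> \<open>At \<open>w\<close> the power \<open>f ^ p\<close> vanishes, so the Frobenius
      congruence leaves only the value of \<open>f\<close> at \<open>y = w ^ p\<close>.\<close>
    have "- ipoly f y = of_nat p * ipoly k w"
      using arg_cong[OF k, of "\<lambda>q. ipoly q w"] p
      by (simp add: ipoly_simps ipoly_subst_power fw y_def[symmetric] prime_gt_0_nat zero_power of_nat_ev)
    then have fy: "ipoly f y = - of_nat p * ipoly k w" by (metis minus_minus mult_minus_left)
    have pd: "pderiv u = smult (int m) (Polynomial.monom 1 (m - 1))"
      unfolding u_def by (simp add: pderiv_diff pderiv_monom smult_monom)
    \<comment> \<open>As \<open>h\<close> vanishes at \<open>y\<close>, the product rule for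
      \<open>u = f * h\<close> keeps a single term.\<close>
    have "of_nat m * y ^ (m - 1) = ipoly (pderiv u) y"
      by (simp add: pd ipoly_smult ipoly_monom)
    also have "\<dots> = ipoly f y * ipoly (pderiv h) y"
      unfolding u pderiv_mult by (simp add: ipoly_simps h)
    also have "\<dots> = - of_nat p * ipoly k w * ipoly (pderiv h) y" by (simp add: fy)
    finally have "of_nat m * y ^ (m - 1) * y = - of_nat p * ipoly k w * ipoly (pderiv h) y * y" by simp
    moreover have "y ^ (m - 1) * y = 1" using y m by (metis power_minus_mult)
    ultimately have e: "of_nat m + of_nat p * (ipoly k w * ipoly (pderiv h) y * y) = 0"
      by (simp add: mult.assoc)
    \<comment> \<open>Because \<open>y\<close> is a power of \<open>w\<close>, the whole cofactor of
      \<open>p\<close> is the value at \<open>w\<close> of an integer polynomial.\<close>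
    define s where "s = k * subst_power (pderiv h) p * Polynomial.monom 1 p"
    have "ipoly (of_nat m + of_nat p * s) w = 0"
      using e by (simp add: ipoly_simps of_nat_ev s_def ipoly_subst_power ipoly_monom y_def)
    then have d: "f dvd of_nat m + of_nat p * s" by (simp add: f)
    \<comment> \<open>Replacing \<open>s\<close> by its remainder gives a multiple of
      \<open>f\<close> of smaller degree than \<open>f\<close>, hence zero. Its constant coefficient
      then exhibits \<open>p\<close> as a divisor of \<open>m\<close>.\<close>
    obtain q v where qv: "s = f * q + v" and v: "v = 0 \<or> Polynomial.degree v < Polynomial.degree f"
      using monic_div_mod[OF lf] by blast
    have "f dvd (of_nat m + of_nat p * s) - f * (of_nat p * q)" by (intro dvd_diff d) simp
    then have dv: "f dvd of_nat m + of_nat p * v" by (simp add: qv algebra_simps)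
    have "Polynomial.degree (of_nat m + of_nat p * v) < Polynomial.degree f"
    proof (rule degree_add_less)
      show "Polynomial.degree (of_nat m :: int poly) < Polynomial.degree f" using df by simp
      show "Polynomial.degree (of_nat p * v) < Polynomial.degree f"
        using v df by (auto simp: of_nat_poly intro: le_less_trans[OF degree_smult_le])
    qed
    then have "of_nat m + of_nat p * v = 0" using dv
      by (metis dvd_imp_degree_le not_le)
    then have "int m + int p * Polynomial.coeff v 0 = 0"
      by (metis (no_types, lifting) coeff_0 coeff_add coeff_mult_0 coeff_pCons_0 of_nat_poly)
    then have "int p dvd int m" by (metis add_eq_0_iff dvd_minus_iff dvd_triv_left)
    then show False using pm by simp
  qed
  then show ?thesis using g f ipoly_dvd_0 y_def by blast
qed

text \<open>Prime factors of \<open>k\<close> are split off one at a time; \<open>w\<close> is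
  generalized because the next step starts from \<open>w ^ p\<close>.\<close>

lemma ipoly_root_power:
  fixes w :: complex
  assumes "w ^ m = 1" "m > 0" "coprime k m" "ipoly g w = 0"
  shows "ipoly g (w ^ k) = 0"
  using assms
proof (induction k arbitrary: w rule: less_induct)
  case (less k)
  show ?case
  proof (cases "k \<le> 1")
    case True
    \<comment> \<open>For \<open>k = 0\<close> coprimality forces \<open>m = 1\<close>, so
      \<open>w\<close> is 1 and nothing changes.\<close>
    then have "k = 0 \<or> k = 1" by auto
    then show ?thesis using less.prems by auto
  next
    case False
    then obtain p where p: "prime p" "p dvd k" using prime_factor_nat[of k] by auto
    then obtain l where l: "k = p * l" by (meson dvdE)
    have "l > 0" using False l by (cases l) auto
    then have "l < k" using prime_gt_1_nat[OF p(1)] by (simp add: l)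
    moreover have "coprime l m" using less.prems(3) by (simp add: l)
    moreover have "\<not> p dvd m"
      using p less.prems(3) by (metis coprime_common_divisor not_prime_unit)
    moreover have "(w ^ p) ^ m = 1" using less.prems(1) by (metis power_mult mult.commute power_one)
    ultimately have "ipoly g ((w ^ p) ^ l) = 0"
      using less.prems p by (intro less.IH ipoly_root_prime_power) auto
    then show ?thesis by (simp add: l power_mult)
  qed
qed

section \<open>Powers of zeta and conjugate evaluation points\<close>

lemma zeta_conv_cis: "zeta m = cis (2 * pi / real m)"
  by (simp add: zeta_def cis_conv_exp mult_ac)

lemma zeta_power: "zeta m ^ k = cis (2 * pi * real k / real m)"
  by (simp add: zeta_conv_cis Complex.DeMoivre) (simp add: mult_ac)

lemma zeta_power_self: "m > 0 \<Longrightarrow> zeta m ^ m = 1"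
  by (simp add: zeta_power)

lemma zeta_nonzero [simp]: "zeta m \<noteq> 0"
  by (simp add: zeta_def)

lemma zeta_power_cong:
  assumes "m > 0" "[k = l] (mod m)"
  shows "zeta m ^ k = zeta m ^ l"
proof -
  have "zeta m ^ n = zeta m ^ (n mod m)" for n
    by (metis assms(1) div_mult_mod_eq mult.commute mult_1 power_add power_mult power_one zeta_power_self)
  then show ?thesis using assms(2) unfolding cong_def by metis
qed

lemma bij_betw_zeta_power: "m > 0 \<Longrightarrow> bij_betw (\<lambda>k. zeta m ^ k) {..<m} {z. z ^ m = 1}"
  unfolding zeta_power by (rule Complex.bij_betw_roots_unity)

lemma zeta_power_eq_iff:
  assumes "m > 0"
  shows "zeta m ^ k = zeta m ^ l \<longleftrightarrow> [k = l] (mod m)"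
proof
  assume "zeta m ^ k = zeta m ^ l"
  then have "zeta m ^ (k mod m) = zeta m ^ (l mod m)"
    using zeta_power_cong[OF assms, of "k mod m" k] zeta_power_cong[OF assms, of "l mod m" l] by simp
  then show "[k = l] (mod m)"
    using bij_betw_zeta_power[OF assms] assms
    unfolding bij_betw_def cong_def by (auto dest: inj_onD)
qed (rule zeta_power_cong[OF assms])

lemma zeta_power_eq_1_iff: "m > 0 \<Longrightarrow> zeta m ^ k = 1 \<longleftrightarrow> m dvd k"
  using zeta_power_eq_iff[of m k 0] by (simp add: cong_0_iff)

lemma root_of_unity_eq_zeta_power:
  assumes "m > 0" "z ^ m = 1"
  obtains k where "k < m" "z = zeta m ^ k"
  using bij_betw_zeta_power[OF assms(1)] assms(2) that unfolding bij_betw_def by blast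

text \<open>The power lemma gives one direction; applied to the root \<open>zeta m ^ k\<close> with
  an inverse of \<open>k\<close> modulo \<open>m\<close> as exponent, it gives the other.\<close>

lemma ipoly_conjugate_iff:
  assumes m: "m > 0" and k: "coprime k m"
  shows "ipoly g (zeta m ^ k) = 0 \<longleftrightarrow> ipoly g (zeta m) = 0"
proof
  assume a: "ipoly g (zeta m ^ k) = 0"
  obtain l where l: "[k * l = 1] (mod m)" using k by (metis cong_solve_coprime_nat One_nat_def)
  then have "coprime (k * l) m" by (metis cong_imp_coprime cong_sym coprime_1_left)
  then have lm: "coprime l m" by simp
  have "(zeta m ^ k) ^ m = 1" by (metis m power_mult mult.commute power_one zeta_power_self)
  from ipoly_root_power[OF this m lm a] have "ipoly g (zeta m ^ (k * l)) = 0" by (simp add: power_mult)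
  then show "ipoly g (zeta m) = 0" using zeta_power_cong[OF m l] by simp
qed (use ipoly_root_power[OF zeta_power_self[OF m] m k] in auto)

text \<open>Let \<open>z = zeta m ^ k\<close>. Its minimal polynomial \<open>f'\<close> divides
  \<open>f\<close>, and by minimality of \<open>f\<close> it also vanishes at \<open>zeta m\<close>.
  But \<open>f'\<close> divides \<open>X^n - 1\<close> with \<open>n = m / gcd k m\<close>, so the
  order \<open>m\<close> of \<open>zeta m\<close> divides \<open>n\<close> and the gcd is 1.\<close>

lemma minpoly_roots_primitive:
  assumes m: "m > 0" and f: "\<And>g. ipoly g (zeta m) = 0 \<longleftrightarrow> f dvd g" and lf: "lead_coeff f = 1"
    and z: "ipoly f z = 0"
  obtains k where "coprime k m" "z = zeta m ^ k"
proof -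
  have "f dvd Polynomial.monom 1 m - 1"
    using m by (simp add: f[symmetric] ipoly_unity zeta_power_self)
  then have "z ^ m = 1" using z ipoly_dvd_0 ipoly_unity by (metis eq_iff_diff_eq_0)
  then obtain k where k: "z = zeta m ^ k" using root_of_unity_eq_zeta_power[OF m] by metis
  obtain f' where lf': "lead_coeff f' = 1" and f': "\<And>g. ipoly g z = 0 \<longleftrightarrow> f' dvd g"
    and df': "Polynomial.degree f' > 0"
    by (rule root_of_unity_minpoly[OF \<open>z ^ m = 1\<close> m]) blast
  have "f' dvd f" using f' z by simp
  then obtain q where q: "f = f' * q" by (auto elim: dvdE)
  have "ipoly f' (zeta m) * ipoly q (zeta m) = 0" using f[of f] by (simp add: q ipoly_simps)
  moreover have "ipoly q (zeta m) \<noteq> 0"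
  proof
    assume "ipoly q (zeta m) = 0"
    then have "f dvd q" by (simp add: f)
    moreover have "q \<noteq> 0" using lf q by auto
    moreover have "f' \<noteq> 0" using lf' by auto
    ultimately show False using df' q by (auto dest!: dvd_imp_degree_le simp: degree_mult_eq)
  qed
  ultimately have f'z: "ipoly f' (zeta m) = 0" by simp
  define d where "d = gcd k m"
  obtain n l where n: "m = d * n" "k = d * l" by (metis d_def gcd_dvd1 gcd_dvd2 dvdE)
  have "n > 0" using m n by (cases n) auto
  have "z ^ n = 1" unfolding k power_mult[symmetric] using m
    by (subst zeta_power_eq_1_iff) (auto simp: n)
  then have "f' dvd Polynomial.monom 1 n - 1" by (simp add: f'[symmetric] ipoly_unity)
  then have "zeta m ^ n = 1" using f'z ipoly_dvd_0 ipoly_unity by (metis eq_iff_diff_eq_0)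
  then have "m dvd n" using m by (simp add: zeta_power_eq_1_iff)
  then have "m \<le> n" using \<open>n > 0\<close> by (auto dest: dvd_imp_le)
  then have "d = 1" using n m by (cases d) auto
  then show ?thesis using that k d_def by (auto simp: coprime_iff_gcd_eq_1)
qed

section \<open>Descent of Galois-invariant quantities to the integers\<close>

text \<open>Reduce \<open>g\<close> modulo the monic minimal polynomial \<open>f\<close> to
  \<open>s\<close>. Then \<open>s - c\<close> vanishes at all roots of \<open>f\<close>; these are
  distinct and more numerous than the degree of \<open>s - c\<close>, so \<open>s\<close> is the
  constant \<open>c\<close> and has integer coefficients.\<close>

lemma galois_invariant_imp_int:
  assumes m: "m > 0" and inv: "\<And>k. coprime k m \<Longrightarrow> ipoly g (zeta m ^ k) = ipoly g (zeta m)"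
  shows "ipoly g (zeta m) \<in> \<int>"
proof -
  obtain f where lf: "lead_coeff f = 1" and f: "\<And>g. ipoly g (zeta m) = 0 \<longleftrightarrow> f dvd g"
    and df: "Polynomial.degree f > 0"
    by (rule root_of_unity_minpoly[OF zeta_power_self[OF m] m]) blast
  define c where "c = ipoly g (zeta m)"
  obtain q s where qs: "g = f * q + s" and s: "s = 0 \<or> Polynomial.degree s < Polynomial.degree f"
    using monic_div_mod[OF lf] by blast
  define F where "F = (map_poly of_int f :: complex poly)"
  define R where "R = (map_poly of_int s - [:c:] :: complex poly)"
  have F0: "F \<noteq> 0" using lf unfolding F_def by (metis map_poly_eq_0_iff of_int_eq_0_iff lead_coeff_pCons(2) leading_coeff_0_iff of_int_0 zero_neq_one)
  have dF: "Polynomial.degree F = Polynomial.degree f" by (simp add: F_def degree_map_poly)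
  have sub: "{z. poly F z = 0} \<subseteq> {z. poly R z = 0}"
  proof clarify
    fix z assume "poly F z = 0"
    then have z: "ipoly f z = 0" by (simp add: F_def ipoly_def)
    then obtain k where k: "coprime k m" "z = zeta m ^ k"
      using minpoly_roots_primitive[OF m f lf] by blast
    then have "ipoly g z = c" using inv c_def by simp
    then have "ipoly s z = c" by (simp add: qs ipoly_simps z)
    then show "poly R z = 0" by (simp add: R_def ipoly_def)
  qed
  have "card {z. poly F z = 0} = Polynomial.degree F"
  proof -
    obtain h where h: "Polynomial.monom 1 m - 1 = f * h"
      using f[of "Polynomial.monom 1 m - 1"] zeta_power_self[OF m] by (auto simp: ipoly_unity elim: dvdE)
    have pd: "pderiv (Polynomial.monom 1 m - 1 :: int poly) = smult (int m) (Polynomial.monom 1 (m - 1))"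
      by (simp add: pderiv_diff pderiv_monom smult_monom)
    have sf: "rsquarefree F"
      unfolding rsquarefree_roots
    \<comment> \<open>A multiple root of \<open>f\<close> would be one of \<open>X^m - 1\<close>,
      whose derivative vanishes at most at 0.\<close>
    proof (intro allI notI, elim conjE)
      fix z assume "poly F z = 0" "poly (pderiv F) z = 0"
      moreover have "pderiv F = map_poly of_int (pderiv f)"
        unfolding F_def by (intro poly_eqI) (simp add: coeff_pderiv coeff_map_poly)
      ultimately have z: "ipoly f z = 0" "ipoly (pderiv f) z = 0" by (simp_all add: F_def ipoly_def)
      have "z ^ m = 1" using arg_cong[OF h, of "\<lambda>p. ipoly p z"] by (simp add: ipoly_monom ipoly_simps z)
      then have "z \<noteq> 0" using m by (auto simp: zero_power)
      have "of_nat m * z ^ (m - 1) = ipoly (pderiv (f * h)) z"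
        unfolding h[symmetric] pd by (simp add: ipoly_smult ipoly_monom)
      also have "\<dots> = 0" unfolding pderiv_mult by (simp add: ipoly_simps z)
      finally show False using \<open>z \<noteq> 0\<close> m by simp
    qed
    have "Polynomial.degree F = Polynomial.degree (smult (lead_coeff F) (\<Prod>z | poly F z = 0. [:- z, 1:]))"
      by (simp only: complex_poly_decompose_rsquarefree[OF sf])
    then show ?thesis using F0 by (simp add: degree_prod_sum_eq)
  qed
  moreover have "R \<noteq> 0 \<Longrightarrow> card {z. poly F z = 0} \<le> Polynomial.degree R"
    using card_mono[OF poly_roots_finite sub] card_poly_roots_bound[of R] by linarith
  moreover have "Polynomial.degree R < Polynomial.degree F"
    unfolding R_def
  proof (rule degree_diff_less)
    show "Polynomial.degree (map_poly of_int s :: complex poly) < Polynomial.degree F"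
      using s df dF by (auto simp: degree_map_poly)
    show "Polynomial.degree [:c:] < Polynomial.degree F" using df dF by simp
  qed
  ultimately have "R = 0" by linarith
  then have "c = Polynomial.coeff (map_poly of_int s) 0"
    unfolding R_def by (metis coeff_pCons_0 eq_iff_diff_eq_0)
  then show ?thesis by (simp add: c_def[symmetric] coeff_map_poly)
qed

lemma galois_invariant_prod_imp_int_poly:
  assumes m: "m > 0" and fin: "finite I"
    and inv: "\<And>k. coprime k m \<Longrightarrow>
      (\<Prod>i\<in>I. [:- ipoly (G i) (zeta m ^ k), 1:]) = (\<Prod>i\<in>I. [:- ipoly (G i) (zeta m), 1:])"
  obtains P :: "int poly" where "map_poly of_int P = (\<Prod>i\<in>I. [:- ipoly (G i) (zeta m), 1:])"
proof -
  \<comment> \<open>\<open>B\<close> has coefficients in the integer polynomials; specializing them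
    at \<open>zeta m ^ k\<close> yields every conjugate product at once, so invariance passes to
    each coefficient.\<close>
  define B where "B = (\<Prod>i\<in>I. [:- G i, 1:])"
  have ev: "map_poly (\<lambda>g. ipoly g z) B = (\<Prod>i\<in>I. [:- ipoly (G i) z, 1:])" for z :: complex
  proof -
    interpret H: unital_ring_hom "map_poly (\<lambda>g. ipoly g z)"
      by (rule ipoly_hom.unital_ring_hom_map_poly)
    show ?thesis unfolding B_def
      by (simp add: H.hom_prod map_poly_pCons ipoly_simps map_poly_1')
  qed
  have "Polynomial.coeff (\<Prod>i\<in>I. [:- ipoly (G i) (zeta m), 1:]) n \<in> \<int>" for n
  proof -
    have c: "Polynomial.coeff (\<Prod>i\<in>I. [:- ipoly (G i) z, 1:]) n = ipoly (Polynomial.coeff B n) z" for z :: complex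
      by (subst ev[symmetric], subst coeff_map_poly) (simp_all add: ipoly_simps)
    show ?thesis unfolding c
      by (rule galois_invariant_imp_int[OF m]) (simp add: c[symmetric] inv)
  qed
  then show ?thesis using that by (metis intpolyE)
qed

section \<open>Degrees of irreducible factors\<close>

lemma rat_poly_clear_denominators:
  obtains d :: int and q' :: "int poly" where "d \<noteq> 0" "map_poly of_int q' = smult (of_int d) (q :: rat poly)"
proof -
  have "\<exists>d q'. d \<noteq> 0 \<and> map_poly of_int q' = smult (of_int d) q"
  proof (induction q)
    case 0
    then show ?case by (intro exI[of _ 1] exI[of _ 0]) simp
  next
    case (pCons a q)
    then obtain d q' where IH: "d \<noteq> 0" "map_poly of_int q' = smult (of_int d) q" by blast
    obtain n e where a: "quotient_of a = (n, e)" by fastforce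
    have e: "e > 0" "a = of_int n / of_int e" using a quotient_of_denom_pos quotient_of_div by blast+
    have "map_poly of_int (pCons (d * n) (smult e q')) = smult (of_int (d * e)) (pCons a q)"
      using e(1) by (simp add: map_poly_pCons map_poly_smult IH e(2) mult_ac)
    moreover have "d * e \<noteq> 0" using IH e by simp
    ultimately show ?case by blast
  qed
  then show ?thesis using that by blast
qed

lemma irreducible_dvd_if_common_root:
  fixes q p :: "rat poly" and z :: "'a::field_char_0"
  assumes q: "Factorial_Ring.irreducible q"
    and "poly (map_poly of_rat q) z = 0" "poly (map_poly of_rat p) z = 0"
  shows "q dvd p"
proof (rule ccontr)
  assume "\<not> q dvd p"
  then have "coprime q p" using q by (metis prime_elem_imp_coprime irreducible_imp_prime_elem_gcd)
  then obtain a b where "a * q + b * p = 1" by (metis bezout_coefficients_fst_snd coprime_imp_gcd_eq_1)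
  then have "poly (map_poly of_rat (a * q + b * p)) z = 1" by simp
  then show False
    using assms by (simp add: of_rat_poly_hom.hom_add of_rat_poly_hom.hom_mult)
qed

lemma even_card_involution:
  fixes m :: nat
  assumes "finite A" "\<And>k. k \<in> A \<Longrightarrow> k < m \<and> m - k \<in> A \<and> 2 * k \<noteq> m"
  shows "even (card A)"
proof -
  define B where "B = {k \<in> A. 2 * k < m}"
  have "A = B \<union> (\<lambda>k. m - k) ` B"
  proof (rule Set.set_eqI)
    fix k show "k \<in> A \<longleftrightarrow> k \<in> B \<union> (\<lambda>k. m - k) ` B"
    proof
      assume k: "k \<in> A"
      show "k \<in> B \<union> (\<lambda>k. m - k) ` B"
      proof (cases "2 * k < m")
        case False
        then have "m - k \<in> B" "k = m - (m - k)" using assms(2)[OF k] by (auto simp: B_def)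
        then show ?thesis by blast
      qed (use k B_def in auto)
    qed (use assms(2) B_def in auto)
  qed
  moreover have "B \<inter> (\<lambda>k. m - k) ` B = {}" by (auto simp: B_def)
  moreover have "inj_on (\<lambda>k. m - k) B"
    by (rule inj_onI) (auto simp: B_def)
  moreover have "finite B" using assms(1) by (simp add: B_def)
  ultimately have "card A = 2 * card B" by (simp add: card_Un_disjoint card_image)
  then show ?thesis by simp
qed

lemma ipoly_conjugate_eq_iff:
  assumes "m > 0" "coprime s m"
  shows "ipoly g (zeta m ^ (s * j)) = ipoly g (zeta m ^ (s * k)) \<longleftrightarrow> ipoly g (zeta m ^ j) = ipoly g (zeta m ^ k)"
  using ipoly_conjugate_iff[OF assms, of "subst_power g j - subst_power g k"]
  by (simp add: ipoly_simps ipoly_subst_power flip: power_mult)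

lemma mod_in_totatives:
  assumes "m > 1" "coprime k m"
  shows "k mod m \<in> totatives m"
proof -
  have c: "coprime (k mod m) m" using assms by simp
  then have "k mod m \<noteq> 0" using assms(1) by (cases "k mod m = 0") auto
  then show ?thesis using assms(1) c by (auto simp: in_totatives_iff less_imp_le)
qed

text \<open>\<open>Y\<close> is the set of conjugates of the given root. Equal fibres give
  \<open>totient m = card Y * card H\<close> with \<open>card H\<close> even. The degree of
  \<open>q\<close> is \<open>card Y\<close>: \<open>q\<close> divides a rational polynomial with
  root set \<open>Y\<close>, and every element of \<open>Y\<close> is a root of
  \<open>q\<close>.\<close>

lemma irreducible_degree_dvd_half_totient:
  fixes q :: "rat poly"
  assumes m: "m > 2" and q: "Factorial_Ring.irreducible q"
    and root: "poly (map_poly of_rat q) (ipoly g (zeta m)) = 0"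
    and sym: "\<And>k. coprime k m \<Longrightarrow> k < m \<Longrightarrow> ipoly g (zeta m ^ (m - k)) = ipoly g (zeta m ^ k)"
  shows "Polynomial.degree q dvd totient m div 2"
proof -
  define F where "F = (\<lambda>k. ipoly g (zeta m ^ k))"
  have m0: "m > 0" and m1: "m > 1" using m by auto
  have F_cong: "F j = F k" if "[j = k] (mod m)" for j k
    unfolding F_def using zeta_power_cong[OF m0 that] by simp
  have F_mult: "F (s * j) = F (s * k) \<longleftrightarrow> F j = F k" if "coprime s m" for s j k
    unfolding F_def by (rule ipoly_conjugate_eq_iff[OF m0 that])
  define U where "U = totatives m"
  have finU: "finite U" by (simp add: U_def)
  have U: "k \<in> U \<Longrightarrow> coprime k m \<and> k < m" for k
    using m1 by (auto simp: U_def in_totatives_iff le_less)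
  have modU: "coprime k m \<Longrightarrow> k mod m \<in> U" for k
    unfolding U_def by (rule mod_in_totatives[OF m1])
  define Y where "Y = F ` U"
  have finY: "finite Y" by (simp add: Y_def finU)
  define H where "H = {k \<in> U. F k = F 1}"
  have fibre: "card {k \<in> U. F k = y} = card H" if "y \<in> Y" for y
  proof -
    obtain s where s: "s \<in> U" "y = F s" using \<open>y \<in> Y\<close> by (auto simp: Y_def)
    then have sm: "coprime s m" using U by blast
    then obtain s' where s': "[s * s' = 1] (mod m)" by (metis cong_solve_coprime_nat One_nat_def)
    then have "coprime (s * s') m" by (metis cong_imp_coprime cong_sym coprime_1_left)
    then have s'm: "coprime s' m" by simp
    \<comment> \<open>Multiplication by \<open>s\<close> carries the fibre over \<open>F 1\<close>
      to the fibre over \<open>F s\<close>; the inverse residue \<open>s'\<close> carries it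
      back.\<close>
    have "bij_betw (\<lambda>k. s * k mod m) H {k \<in> U. F k = y}"
    proof (rule bij_betwI[where g = "\<lambda>k. s' * k mod m"])
      show "(\<lambda>k. s * k mod m) \<in> H \<rightarrow> {k \<in> U. F k = y}"
      proof clarsimp
        fix k assume "k \<in> H"
        then have k: "k \<in> U" "F k = F 1" by (auto simp: H_def)
        have "F (s * k) = F (s * 1)" using F_mult[OF sm] k by blast
        then show "s * k mod m \<in> U \<and> F (s * k mod m) = y"
          using modU[of "s * k"] U[OF k(1)] sm s F_cong[of "s * k mod m" "s * k"] by simp
      qed
      show "(\<lambda>k. s' * k mod m) \<in> {k \<in> U. F k = y} \<rightarrow> H"
      proof clarsimp
        fix k assume k: "k \<in> U" "y = F k"
        have "F (s' * k) = F (s' * s)" using F_mult[OF s'm] k s by metis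
        also have "\<dots> = F 1" using s' by (intro F_cong) (simp add: mult.commute)
        finally show "s' * k mod m \<in> H"
          using modU[of "s' * k"] U[OF k(1)] s'm F_cong[of "s' * k mod m" "s' * k"] by (simp add: H_def)
      qed
      have inv: "s' * (s * k mod m) mod m = k" "s * (s' * k mod m) mod m = k" if "k < m" for k
      proof -
        have "[s * s' * k = 1 * k] (mod m)" using s' by (intro cong_mult) auto
        then have e: "(s * s' * k) mod m = k" using that by (simp add: cong_def)
        show "s' * (s * k mod m) mod m = k" using e by (simp add: mod_mult_right_eq mult_ac)
        show "s * (s' * k mod m) mod m = k" using e by (simp add: mod_mult_right_eq mult_ac)
      qed
      show "s' * (s * k mod m) mod m = k" if "k \<in> H" for k
        using that U by (intro inv) (auto simp: H_def)
      show "s * (s' * k mod m) mod m = k" if "k \<in> {k \<in> U. F k = y}" for k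
        using that U by (intro inv) auto
    qed
    then show ?thesis by (simp add: bij_betw_same_card)
  qed
  have "totient m = card U" by (simp add: U_def totient_def)
  also have "U = (\<Union>y\<in>Y. {k \<in> U. F k = y})" by (auto simp: Y_def)
  also have "card \<dots> = (\<Sum>y\<in>Y. card {k \<in> U. F k = y})"
    using finY finU by (intro card_UN_disjoint) auto
  also have "\<dots> = card Y * card H" by (simp add: fibre)
  finally have tot: "totient m = card Y * card H" .
  have "even (card H)"
  proof (rule even_card_involution)
    show "finite H" using finU by (simp add: H_def)
    fix k assume "k \<in> H"
    then have k: "k \<in> U" "F k = F 1" by (auto simp: H_def)
    have km: "coprime k m" "k < m" using U[OF k(1)] by auto
    have "k > 0" using k(1) by (auto simp: U_def in_totatives_iff)
    have "coprime (m - k) m" using km by (metis coprime_diff_one_left_nat coprime_iff_gcd_eq_1 gcd.commute gcd_diff2_nat less_imp_le)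
    then have "m - k \<in> U" using km \<open>k > 0\<close> by (auto simp: U_def in_totatives_iff)
    moreover have "F (m - k) = F k" unfolding F_def by (rule sym[OF km])
    moreover have "2 * k \<noteq> m"
    proof
      assume "2 * k = m"
      then have "k dvd m" by (metis dvd_triv_right)
      then have "k = 1" using km(1) by (metis coprime_absorb_left nat_dvd_1_iff_1)
      then show False using \<open>2 * k = m\<close> m by simp
    qed
    ultimately show "k < m \<and> m - k \<in> H \<and> 2 * k \<noteq> m" using km k by (simp add: H_def)
  qed
  then have dvd: "card Y dvd totient m div 2" unfolding tot by (auto elim!: evenE)
  \<comment> \<open>Choosing an exponent for each conjugate writes the elements of \<open>Y\<close>
    as values of integer polynomials at \<open>zeta m\<close>, the form needed for the descent to
    integer coefficients.\<close>
  define rep where "rep = (\<lambda>y. SOME k. k \<in> U \<and> F k = y)"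
  have rep: "rep y \<in> U \<and> F (rep y) = y" if "y \<in> Y" for y
    unfolding rep_def by (rule someI_ex) (use that in \<open>auto simp: Y_def\<close>)
  define G where "G = (\<lambda>y. subst_power g (rep y))"
  have G: "ipoly (G y) (zeta m ^ k) = F (k * rep y)" for y k
    by (simp add: G_def F_def ipoly_subst_power power_mult)
  have orbit: "(\<Prod>y\<in>Y. [:- ipoly (G y) (zeta m ^ k), 1:]) = (\<Prod>y\<in>Y. [:- y, 1:])" if k: "coprime k m" for k
  proof (rule prod.reindex_bij_betw)
    let ?h = "\<lambda>y. ipoly (G y) (zeta m ^ k)"
    have "inj_on ?h Y"
      by (rule inj_onI) (metis G F_mult[OF k] rep)
    moreover have "?h ` Y \<subseteq> Y"
    proof (clarsimp simp: G)
      fix y assume "y \<in> Y"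
      then have "(k * rep y) mod m \<in> U" using rep U k by (intro modU) simp
      moreover have "F (k * rep y) = F ((k * rep y) mod m)" by (rule F_cong) simp
      ultimately show "F (k * rep y) \<in> Y" by (simp add: Y_def)
    qed
    ultimately show "bij_betw ?h Y Y"
      unfolding bij_betw_def using finY by (simp add: endo_inj_surj)
  qed
  obtain P where P: "map_poly of_int P = (\<Prod>y\<in>Y. [:- ipoly (G y) (zeta m), 1:])"
    using galois_invariant_prod_imp_int_poly[OF m0 finY, of G] orbit orbit[of 1] by auto
  then have P: "map_poly of_int P = (\<Prod>y\<in>Y. [:- y, 1:])" using orbit[of 1] by simp
  define R where "R = (map_poly of_int P :: rat poly)"
  have R: "map_poly of_rat R = (\<Prod>y\<in>Y. [:- y, 1:])"
    unfolding R_def P[symmetric] by (simp add: map_poly_map_poly o_def)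
  have "Polynomial.degree (map_poly of_rat R :: complex poly) = card Y"
    unfolding R by (simp add: degree_prod_sum_eq)
  then have dR: "Polynomial.degree R = card Y" by (simp add: degree_map_poly)
  have "R \<noteq> 0"
  proof
    assume "R = 0"
    then have "(\<Prod>y\<in>Y. [:- y, 1:]) = (0 :: complex poly)" using R by simp
    then show False using finY by simp
  qed
  have F1: "F 1 = ipoly g (zeta m)" by (simp add: F_def)
  have "1 \<in> U" using m1 by (simp add: U_def in_totatives_iff)
  then have "poly (map_poly of_rat R) (F 1) = 0"
    unfolding R poly_prod using finY by (auto simp: Y_def)
  then have "q dvd R" using root F1 by (intro irreducible_dvd_if_common_root[OF q, of "F 1"]) auto
  then have le: "Polynomial.degree q \<le> card Y" using \<open>R \<noteq> 0\<close> dR dvd_imp_degree_le by metis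
  \<comment> \<open>With denominators cleared, the composition with \<open>g\<close> is an integer
    polynomial, so its vanishing passes to all conjugates.\<close>
  obtain d q' where q': "d \<noteq> 0" "map_poly of_int q' = smult (of_int d) q"
    by (rule rat_poly_clear_denominators)
  have ev: "ipoly q' z = of_int d * poly (map_poly of_rat q) z" for z :: complex
  proof -
    have "(map_poly of_int q' :: complex poly) = map_poly of_rat (map_poly of_int q')"
      by (simp add: map_poly_map_poly o_def)
    also have "\<dots> = smult (of_int d) (map_poly of_rat q)"
      unfolding q' by (simp add: map_poly_smult of_rat_mult)
    finally show ?thesis by (simp add: ipoly_def)
  qed
  have "Y \<subseteq> {z. poly (map_poly of_rat q) z = 0}"
  proof (clarsimp simp: Y_def)
    fix k assume "k \<in> U"
    then have "ipoly (q' \<circ>\<^sub>p g) (zeta m ^ k) = 0"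
      using ipoly_conjugate_iff[OF m0, of k "q' \<circ>\<^sub>p g"] U root by (simp add: ipoly_pcompose ev)
    then show "poly (map_poly of_rat q) (F k) = 0" using q'(1) by (simp add: ipoly_pcompose ev F_def)
  qed
  moreover have q0: "map_poly of_rat q \<noteq> (0 :: complex poly)"
    using q by (auto simp: map_poly_eq_0_iff)
  ultimately have "card Y \<le> Polynomial.degree (map_poly of_rat q :: complex poly)"
    using card_poly_roots_bound[OF q0] card_mono[OF poly_roots_finite[OF q0], of Y] by linarith
  then have "Polynomial.degree q = card Y" using le by (simp add: degree_map_poly)
  then show ?thesis using dvd by simp
qed

section \<open>The action on points\<close>

lemma residue_ring_carrier: "carrier (residue_ring (int m)) = {0..int m - 1}"
  by (simp add: residue_ring_def)

lemma Units_residue_ring: "m > 1 \<Longrightarrow> Units (residue_ring (int m)) = {t. 0 < t \<and> t < int m \<and> coprime t (int m)}"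
  by (intro residues.res_units_eq) (simp add: residues_def)

lemma mult_set_eq: "mult_set m t S = (\<lambda>s. t * s mod int m) ` S"
  by (simp add: mult_set_def residue_ring_def)

lemma inj_on_mult_mod:
  assumes "coprime t (int m)"
  shows "inj_on (\<lambda>s. t * s mod int m) {0..int m - 1}"
proof (rule inj_onI)
  fix x y assume xy: "x \<in> {0..int m - 1}" "y \<in> {0..int m - 1}" "t * x mod int m = t * y mod int m"
  then have "[x = y] (mod int m)"
    using assms by (metis cong_def cong_mult_lcancel)
  then show "x = y" using xy by (simp add: cong_def)
qed

lemma finite_zero_subsets: "finite (zero_subsets m N)"
  by (rule finite_subset[of _ "Pow {0..int m - 1}"]) (auto simp: zero_subsets_def residue_ring_carrier)

text \<open>A unit acts injectively on residues, hence on subsets; an injective self-map of a finite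
  collection is bijective.\<close>

lemma bij_betw_mult_set:
  assumes m: "m > 0" and t: "coprime t (int m)"
  shows "bij_betw (mult_set m t) (zero_subsets m N) (zero_subsets m N)"
proof -
  note inj = inj_on_mult_mod[OF t]
  have "inj_on (mult_set m t) (zero_subsets m N)"
    by (rule inj_onI)
      (simp add: zero_subsets_def residue_ring_carrier mult_set_eq inj_on_image_eq_iff[OF inj])
  moreover have "mult_set m t ` zero_subsets m N \<subseteq> zero_subsets m N"
  proof clarify
    fix S assume S: "S \<in> zero_subsets m N"
    then have "card (mult_set m t S) = N"
      by (simp add: zero_subsets_def residue_ring_carrier mult_set_eq card_image inj_on_subset[OF inj])
    moreover have "0 \<in> mult_set m t S"
      using S unfolding mult_set_eq zero_subsets_def by (auto intro: image_eqI[of _ _ 0])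
    moreover have "mult_set m t S \<subseteq> {0..int m - 1}"
      using m by (auto simp: mult_set_eq)
    ultimately show "mult_set m t S \<in> zero_subsets m N"
      by (simp add: zero_subsets_def residue_ring_carrier)
  qed
  ultimately show ?thesis
    unfolding bij_betw_def using finite_zero_subsets by (simp add: endo_inj_surj)
qed

section \<open>Points as subsets containing zero\<close>

lemma points_strict_sorted:
  assumes "x \<in> points m N"
  shows "sorted_wrt (<) (0 # x)" "distinct (0 # x)" "sorted (0 # x)"
proof -
  show *: "sorted_wrt (<) (0 # x)"
    using assms by (simp add: points_def sorted_wrt_append)
  show "distinct (0 # x)" "sorted (0 # x)" using * strict_sorted_iff by blast+
qed

lemma bij_betw_underlying:
  assumes N: "N > 0" and m: "m > 0"
  shows "bij_betw underlying (points m N) (zero_subsets m N)"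
proof (rule bij_betwI[where g = "\<lambda>S. tl (sorted_list_of_set S)"])
  show "underlying \<in> points m N \<rightarrow> zero_subsets m N"
  proof
    fix x assume x: "x \<in> points m N"
    have "card (underlying x) = N"
      unfolding underlying_def distinct_card[OF points_strict_sorted(2)[OF x]]
      using x N by (simp add: points_def)
    moreover have "underlying x \<subseteq> {0..int m - 1}"
      using x m by (fastforce simp: points_def underlying_def sorted_wrt_append)
    ultimately show "underlying x \<in> zero_subsets m N"
      by (simp add: zero_subsets_def residue_ring_carrier underlying_def)
  qed
  \<comment> \<open>Sorting a subset that contains 0 puts 0 first, so \<open>tl\<close> removes
    exactly the conventional coordinate.\<close>
  have list: "0 # tl (sorted_list_of_set S) = sorted_list_of_set S" if "S \<in> zero_subsets m N" for S
  proof -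
    have S: "S \<subseteq> {0..int m - 1}" "0 \<in> S" using that by (auto simp: zero_subsets_def residue_ring_carrier)
    then have fin: "finite S" using finite_subset by blast
    have "Min S = 0" using S fin by (intro Min_eqI) auto
    moreover have "S \<noteq> {}" using S by auto
    ultimately show ?thesis using sorted_list_of_set_nonempty[OF fin] by simp
  qed
  show "(\<lambda>S. tl (sorted_list_of_set S)) \<in> zero_subsets m N \<rightarrow> points m N"
  proof
    fix S assume SZ: "S \<in> zero_subsets m N"
    then have S: "S \<subseteq> {0..int m - 1}" "card S = N" by (auto simp: zero_subsets_def residue_ring_carrier)
    then have fin: "finite S" using finite_subset by blast
    have "sorted_wrt (<) (sorted_list_of_set S @ [int m])"
      using S fin by (auto simp: sorted_wrt_append)
    then have "sorted_wrt (<) ((0 # tl (sorted_list_of_set S)) @ [int m])" by (simp only: list[OF SZ])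
    then show "tl (sorted_list_of_set S) \<in> points m N"
      using S by (simp add: points_def)
  qed
  show "tl (sorted_list_of_set (underlying x)) = x" if "x \<in> points m N" for x
    using points_strict_sorted[OF that] unfolding underlying_def
    by (metis list.sel(3) sorted_list_of_set.idem_if_sorted_distinct)
  show "underlying (tl (sorted_list_of_set S)) = S" if "S \<in> zero_subsets m N" for S
  proof -
    have "finite S" using that finite_subset by (fastforce simp: zero_subsets_def residue_ring_carrier)
    then show ?thesis unfolding underlying_def list[OF that] by simp
  qed
qed

lemma finite_points: "N > 0 \<Longrightarrow> m > 0 \<Longrightarrow> finite (points m N)"
  using bij_betw_finite[OF bij_betw_underlying] finite_zero_subsets by blast

lemma ex1_act:
  assumes "N > 0" "m > 0" "coprime t (int m)" "x \<in> points m N"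
  shows "\<exists>!y. y \<in> points m N \<and> underlying y = mult_set m t (underlying x)"
proof -
  note u = bij_betw_underlying[OF assms(1,2)]
  have "mult_set m t (underlying x) \<in> zero_subsets m N"
    using bij_betwE[OF u] bij_betwE[OF bij_betw_mult_set[OF assms(2,3)]] assms(4) by blast
  then show ?thesis
    using u unfolding bij_betw_def inj_on_def by (metis (no_types, lifting) imageE)
qed

lemma act:
  assumes "N > 0" "m > 0" "coprime t (int m)" "x \<in> points m N"
  shows "act m N t x \<in> points m N" "underlying (act m N t x) = mult_set m t (underlying x)"
  using theI'[OF ex1_act[OF assms]] unfolding act_def by auto

text \<open>Through the bijection \<open>underlying\<close>, \<open>act\<close> is multiplication of
  subsets transported to points.\<close>

lemma bij_betw_act:
  assumes "N > 0" "m > 0" "coprime t (int m)"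
  shows "bij_betw (act m N t) (points m N) (points m N)"
proof -
  note u = bij_betw_underlying[OF assms(1,2)]
  have "bij_betw (inv_into (points m N) underlying \<circ> (mult_set m t \<circ> underlying)) (points m N) (points m N)"
    by (intro bij_betw_trans[OF bij_betw_trans[OF u bij_betw_mult_set[OF assms(2,3)]]] bij_betw_inv_into[OF u])
  moreover have "act m N t x = (inv_into (points m N) underlying \<circ> (mult_set m t \<circ> underlying)) x"
    if "x \<in> points m N" for x
    using act[OF assms that] u by (simp add: bij_betw_def inv_into_f_eq)
  ultimately show ?thesis by (simp cong: bij_betw_cong)
qed

section \<open>Discriminants as products over ordered pairs\<close>

lemma zeta_powi: "zeta m powi k = exp (2 * of_real pi * \<i> * of_int k / of_nat m)"
  unfolding zeta_def by (subst exp_power_int) (simp add: mult_ac)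

lemma zeta_powi_conv_power:
  assumes "m > 0"
  shows "zeta m powi k = zeta m ^ nat (k mod int m)"
proof -
  have "zeta m powi k = zeta m powi (int m * (k div int m) + k mod int m)" by simp
  also have "\<dots> = (zeta m powi int m) powi (k div int m) * zeta m powi (k mod int m)"
    by (subst power_int_add) (simp_all add: power_int_mult)
  also have "\<dots> = zeta m powi int (nat (k mod int m))"
    using assms by (simp add: zeta_power_self)
  finally show ?thesis by (simp only: power_int_of_nat)
qed

lemma zeta_powi_cong:
  assumes "m > 0" "[k = l] (mod int m)"
  shows "zeta m powi k = zeta m powi l"
  using assms by (simp add: zeta_powi_conv_power cong_def)

definition offdiag :: "'a set \<Rightarrow> ('a \<times> 'a) set" where
  "offdiag S = {(u, v) \<in> S \<times> S. u \<noteq> v}"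

lemma bij_betw_offdiag:
  assumes "bij_betw f S T"
  shows "bij_betw (map_prod f f) (offdiag S) (offdiag T)"
proof -
  have "inj_on (map_prod f f) (offdiag S)"
    using assms by (fastforce simp: bij_betw_def inj_on_def offdiag_def)
  moreover have "map_prod f f ` offdiag S = offdiag T"
  proof
    show "map_prod f f ` offdiag S \<subseteq> offdiag T"
      using assms by (fastforce simp: bij_betw_def inj_on_def offdiag_def)
    show "offdiag T \<subseteq> map_prod f f ` offdiag S"
    proof clarify
      fix a b assume "(a, b) \<in> offdiag T"
      then have "a \<in> f ` S" "b \<in> f ` S" "a \<noteq> b" using assms by (auto simp: offdiag_def bij_betw_def)
      then obtain u v where "u \<in> S" "v \<in> S" "a = f u" "b = f v" "u \<noteq> v" by blast
      then show "(a, b) \<in> map_prod f f ` offdiag S" by (intro image_eqI[of _ _ "(u, v)"]) (auto simp: offdiag_def)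
    qed
  qed
  ultimately show ?thesis by (simp add: bij_betw_def)
qed

text \<open>The parameter \<open>t\<close> selects a conjugate: 1 gives the discriminant itself, and
  an integer exponent allows -1 for complex conjugation.\<close>

definition diff_prod :: "nat \<Rightarrow> int set \<Rightarrow> int \<Rightarrow> complex" where
  "diff_prod m S t = (\<Prod>(u, v)\<in>offdiag S. 1 - zeta m powi (t * (v - u)))"

text \<open>Reducing the differences modulo \<open>m\<close> makes the exponents nonnegative, so
  that \<open>diff_prod\<close> becomes the value of an integer polynomial at a power of
  \<open>zeta m\<close>.\<close>

definition diff_poly :: "nat \<Rightarrow> int set \<Rightarrow> int poly" where
  "diff_poly m S = (\<Prod>(u, v)\<in>offdiag S. 1 - Polynomial.monom 1 (nat ((v - u) mod int m)))"

lemma ipoly_diff_poly: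
  assumes "m > 0"
  shows "ipoly (diff_poly m S) (zeta m ^ k) = diff_prod m S (int k)"
proof -
  have "(zeta m ^ k) ^ nat (a mod int m) = zeta m powi (int k * a)" for a
  proof -
    have "(zeta m ^ k) ^ nat (a mod int m) = (zeta m ^ nat (a mod int m)) powi int k"
      by (simp add: mult.commute flip: power_mult)
    also have "\<dots> = zeta m powi (a * int k)"
      using assms by (simp add: zeta_powi_conv_power[symmetric] power_int_mult)
    finally show ?thesis by (simp add: mult.commute)
  qed
  then show ?thesis
    by (simp add: diff_poly_def diff_prod_def ipoly_simps ipoly_monom case_prod_beta)
qed

lemma diff_prod_cong:
  assumes "m > 0" "[s = t] (mod int m)"
  shows "diff_prod m S s = diff_prod m S t"
  unfolding diff_prod_def
  by (intro prod.cong refl) (auto intro!: zeta_powi_cong cong_mult assms)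

text \<open>Exchanging the members of each ordered pair changes the sign of every
  difference.\<close>

lemma diff_prod_uminus: "diff_prod m S (- t) = diff_prod m S t"
proof -
  have "bij_betw prod.swap (offdiag S) (offdiag S)"
    by (rule bij_betwI[where g = prod.swap]) (auto simp: offdiag_def)
  then have "diff_prod m S (- t) = (\<Prod>p\<in>offdiag S. case prod.swap p of (u, v) \<Rightarrow> 1 - zeta m powi (- t * (v - u)))"
    unfolding diff_prod_def by (rule prod.reindex_bij_betw[symmetric])
  also have "\<dots> = diff_prod m S t"
    unfolding diff_prod_def by (intro prod.cong refl) (auto simp: algebra_simps)
  finally show ?thesis .
qed

text \<open>The conjugation exponent is absorbed by reindexing along
  \<open>s \<mapsto> t * s mod m\<close>, since the factors depend on differences only modulo
  \<open>m\<close>.\<close>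

lemma diff_prod_mult_set:
  assumes m: "m > 0" and t: "coprime t (int m)" and S: "S \<subseteq> {0..int m - 1}"
  shows "diff_prod m (mult_set m t S) 1 = diff_prod m S t"
proof -
  define f where "f = (\<lambda>s. t * s mod int m)"
  have "bij_betw f S (mult_set m t S)"
    using inj_on_subset[OF inj_on_mult_mod[OF t] S] by (simp add: bij_betw_def f_def mult_set_eq)
  from prod.reindex_bij_betw[OF bij_betw_offdiag[OF this], symmetric]
  have "diff_prod m (mult_set m t S) 1 =
      (\<Prod>p\<in>offdiag S. case map_prod f f p of (u, v) \<Rightarrow> 1 - zeta m powi (1 * (v - u)))"
    unfolding diff_prod_def .
  also have "\<dots> = diff_prod m S t"
    unfolding diff_prod_def
  proof (intro prod.cong refl, clarsimp)
    fix u v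
    have "[f v - f u = t * v - t * u] (mod int m)"
      by (intro cong_diff) (auto simp: f_def)
    then show "zeta m powi (f v - f u) = zeta m powi (t * (v - u))"
      using m by (intro zeta_powi_cong) (simp_all add: right_diff_distrib)
  qed
  finally show ?thesis .
qed

text \<open>Each factor of \<open>r\<close> is \<open>|\<zeta>\<^sup>u - \<zeta>\<^sup>v|\<^sup>2 = (1 - \<zeta>\<^bsup>v-u\<^esup>) (1 - \<zeta>\<^bsup>u-v\<^esup>)\<close>,
  so the product over ordered pairs does not refer to the order of the coordinates.\<close>

lemma r_conv_diff_prod:
  assumes N: "N > 0" and x: "x \<in> points m N"
  shows "complex_of_real (r m N x) = diff_prod m (underlying x) 1"
proof -
  define z where "z = (\<lambda>i. (0 # x) ! i)"
  define T where "T = {(a, b). a < b \<and> b \<le> N - 1}"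
  define h where "h = (\<lambda>(u, v). 1 - zeta m powi (v - u))"
  have len: "length (0 # x) = N" using x N by (simp add: points_def)
  have sq: "complex_of_real ((cmod (zeta m powi u - zeta m powi v))\<^sup>2) = h (u, v) * h (v, u)" for u v
  proof -
    have cnj: "cnj (zeta m powi k) = inverse (zeta m powi k)" for k
    proof -
      have "cmod (zeta m powi k) = 1" unfolding zeta_conv_cis by (simp add: norm_power_int)
      then have "zeta m powi k * cnj (zeta m powi k) = 1"
        using complex_norm_square[of "zeta m powi k"] by simp
      then show ?thesis by (metis inverse_unique)
    qed
    have "complex_of_real ((cmod (zeta m powi u - zeta m powi v))\<^sup>2) =
      (zeta m powi u - zeta m powi v) * (inverse (zeta m powi u) - inverse (zeta m powi v))"
      unfolding complex_norm_square by (simp only: complex_cnj_diff cnj)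
    also have "\<dots> = h (u, v) * h (v, u)"
      by (simp add: h_def power_int_diff field_simps)
    finally show ?thesis .
  qed
  have finT: "finite T" by (rule finite_subset[of _ "{..N - 1} \<times> {..N - 1}"]) (auto simp: T_def)
  \<comment> \<open>Increasing index pairs and their reversals partition the ordered pairs, which
    lets the two factors of each square be regrouped.\<close>
  have off: "offdiag {..<N} = T \<union> prod.swap ` T"
  proof
    show "offdiag {..<N} \<subseteq> T \<union> prod.swap ` T"
    proof clarify
      fix a b assume "(a, b) \<in> offdiag {..<N}" "(a, b) \<notin> prod.swap ` T"
      then have "a < N" "b < N" "a \<noteq> b" "(b, a) \<notin> T" by (auto simp: offdiag_def image_iff)
      then show "(a, b) \<in> T" by (auto simp: T_def)
    qed
    show "T \<union> prod.swap ` T \<subseteq> offdiag {..<N}" using N by (auto simp: T_def offdiag_def)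
  qed
  have bij: "bij_betw z {..<N} (underlying x)"
    unfolding z_def underlying_def
    using points_strict_sorted(2)[OF x] len by (intro bij_betw_nth) auto
  have "complex_of_real (r m N x) = (\<Prod>(a, b)\<in>T. complex_of_real ((cmod (zeta m powi z a - zeta m powi z b))\<^sup>2))"
    unfolding r_def zeta_powi z_def T_def by (simp add: case_prod_beta)
  also have "\<dots> = (\<Prod>(a, b)\<in>T. h (z a, z b)) * (\<Prod>(a, b)\<in>T. h (z b, z a))"
    unfolding prod.distrib[symmetric] by (intro prod.cong refl) (auto simp: sq simp del: of_real_power)
  also have "(\<Prod>(a, b)\<in>T. h (z b, z a)) = (\<Prod>(a, b)\<in>prod.swap ` T. h (z a, z b))"
    by (subst prod.reindex) (auto simp: case_prod_beta)
  also have "(\<Prod>(a, b)\<in>T. h (z a, z b)) * \<dots> = (\<Prod>(a, b)\<in>offdiag {..<N}. h (z a, z b))"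
    unfolding off using finT by (intro prod.union_disjoint[symmetric]) (auto simp: T_def)
  also have "\<dots> = (\<Prod>p\<in>offdiag {..<N}. h (map_prod z z p))"
    by (simp add: case_prod_beta map_prod_def)
  also have "\<dots> = (\<Prod>p\<in>offdiag (underlying x). h p)"
    by (rule prod.reindex_bij_betw[OF bij_betw_offdiag[OF bij]])
  also have "\<dots> = diff_prod m (underlying x) 1"
    by (simp add: diff_prod_def h_def)
  finally show ?thesis .
qed

section \<open>Automorphisms of the cyclotomic field\<close>

lemma cyclo_closed:
  shows "0 \<in> cyclo m" "1 \<in> cyclo m" "zeta m \<in> cyclo m"
    and "a \<in> cyclo m \<Longrightarrow> b \<in> cyclo m \<Longrightarrow> a + b \<in> cyclo m"
    and "a \<in> cyclo m \<Longrightarrow> b \<in> cyclo m \<Longrightarrow> a * b \<in> cyclo m"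
    and "a \<in> cyclo m \<Longrightarrow> - a \<in> cyclo m"
    and "a \<in> cyclo m \<Longrightarrow> a \<noteq> 0 \<Longrightarrow> inverse a \<in> cyclo m"
proof -
  interpret field "ring_of_type_algebra :: complex ring" by rule
  have K: "subfield (cyclo m) ring_of_type_algebra"
    unfolding cyclo_def by (rule generate_field_is_subfield) simp
  note K' = subringE[OF subfieldE(1)[OF K]]
  show "0 \<in> cyclo m" "1 \<in> cyclo m" using K'(2,3) by simp_all
  show "zeta m \<in> cyclo m" unfolding cyclo_def by (rule generate_field.incl) simp
  show "a \<in> cyclo m \<Longrightarrow> b \<in> cyclo m \<Longrightarrow> a + b \<in> cyclo m"
    "a \<in> cyclo m \<Longrightarrow> b \<in> cyclo m \<Longrightarrow> a * b \<in> cyclo m"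
    "a \<in> cyclo m \<Longrightarrow> - a \<in> cyclo m"
    using K'(5-7) by auto
  show "a \<in> cyclo m \<Longrightarrow> a \<noteq> 0 \<Longrightarrow> inverse a \<in> cyclo m"
    using subfield_m_inv(1)[OF K, of a] by auto
qed

lemma of_int_in_cyclo: "of_int a \<in> cyclo m"
proof (induction a rule: int_induct[where k = 0])
  case (step2 i)
  then show ?case using cyclo_closed(4)[OF _ cyclo_closed(6)[OF cyclo_closed(2)], of "of_int i"] by simp
qed (auto intro: cyclo_closed)

lemma ipoly_in_cyclo: "ipoly g (zeta m) \<in> cyclo m"
  by (induction g) (auto simp: ipoly_pCons ipoly_simps intro: cyclo_closed of_int_in_cyclo)

text \<open>Explicit fractions give each field element a form on which an automorphism can be
  computed; they are closed under all operations that generate the field.\<close>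

lemma cyclo_eq: "cyclo m = {ipoly g (zeta m) / ipoly h (zeta m) | g h. ipoly h (zeta m) \<noteq> 0}"
proof (intro equalityI subsetI)
  fix x assume "x \<in> cyclo m"
  then have "\<exists>g h. x = ipoly g (zeta m) / ipoly h (zeta m) \<and> ipoly h (zeta m) \<noteq> 0"
    unfolding cyclo_def
  proof (induction rule: generate_field.induct)
    case one
    then show ?case by (intro exI[of _ 1]) (simp add: ipoly_simps)
  next
    case (incl h)
    then show ?case by (intro exI[of _ "Polynomial.monom 1 1"] exI[of _ 1]) (simp add: ipoly_simps ipoly_monom)
  next
    case (a_inv x)
    then obtain g h where gh: "x = ipoly g (zeta m) / ipoly h (zeta m)" "ipoly h (zeta m) \<noteq> 0" by blast
    then show ?case by (intro exI[of _ "- g"] exI[of _ h]) (simp add: ipoly_simps)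
  next
    case (m_inv x)
    then obtain g h where gh: "x = ipoly g (zeta m) / ipoly h (zeta m)" "ipoly h (zeta m) \<noteq> 0" by blast
    then show ?case using m_inv(2) by (intro exI[of _ h] exI[of _ g]) simp
  next
    case (eng_add x y)
    then obtain g h g' h' where gh: "x = ipoly g (zeta m) / ipoly h (zeta m)" "ipoly h (zeta m) \<noteq> 0"
       "y = ipoly g' (zeta m) / ipoly h' (zeta m)" "ipoly h' (zeta m) \<noteq> 0" by blast
    then show ?case by (intro exI[of _ "g * h' + g' * h"] exI[of _ "h * h'"]) (simp add: ipoly_simps add_frac_eq)
  next
    case (eng_mult x y)
    then obtain g h g' h' where gh: "x = ipoly g (zeta m) / ipoly h (zeta m)" "ipoly h (zeta m) \<noteq> 0"
       "y = ipoly g' (zeta m) / ipoly h' (zeta m)" "ipoly h' (zeta m) \<noteq> 0" by blast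
    then show ?case by (intro exI[of _ "g * g'"] exI[of _ "h * h'"]) (simp add: ipoly_simps)
  qed
  then show "x \<in> {ipoly g (zeta m) / ipoly h (zeta m) | g h. ipoly h (zeta m) \<noteq> 0}" by blast
next
  fix x assume "x \<in> {ipoly g (zeta m) / ipoly h (zeta m) | g h. ipoly h (zeta m) \<noteq> 0}"
  then show "x \<in> cyclo m"
    by (auto simp: divide_inverse intro!: cyclo_closed(5,7) ipoly_in_cyclo)
qed

lemma is_cyclo_aut_iff:
  "is_cyclo_aut m t s \<longleftrightarrow> s \<in> extensional (cyclo m) \<and> bij_betw s (cyclo m) (cyclo m) \<and>
     (\<forall>x\<in>cyclo m. \<forall>y\<in>cyclo m. s (x + y) = s x + s y \<and> s (x * y) = s x * s y) \<and>
     s 1 = 1 \<and> s (zeta m) = zeta m powi t"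
  unfolding is_cyclo_aut_def ring_iso_def ring_hom_def cyclo_ring_def
  by (auto dest: bij_betwE)

text \<open>An automorphism fixes the integers, and evaluation is built from integers and
  \<open>zeta m\<close> by ring operations.\<close>

lemma cyclo_aut_ipoly:
  assumes "is_cyclo_aut m t s"
  shows "s (ipoly g (zeta m)) = ipoly g (zeta m powi t)"
proof -
  note s = assms[unfolded is_cyclo_aut_iff]
  have s0: "s 0 = 0" using s cyclo_closed(1) by (metis add_cancel_right_right add_0)
  have sint: "s (of_int a) = of_int a" for a
  proof (induction a rule: int_induct[where k = 0])
    case (step2 i)
    have "s (of_int (i - 1) + 1) = s (of_int (i - 1)) + s 1"
      using s of_int_in_cyclo cyclo_closed(2) by blast
    then show ?case using step2 s by (simp add: eq_diff_eq)
  qed (use s s0 of_int_in_cyclo cyclo_closed(2) in auto)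
  show ?thesis
  proof (induction g)
    case (pCons a g)
    have "s (of_int a + zeta m * ipoly g (zeta m)) = s (of_int a) + s (zeta m) * s (ipoly g (zeta m))"
      using s of_int_in_cyclo cyclo_closed(3,5) ipoly_in_cyclo by metis
    then show ?case using s pCons.IH by (simp add: ipoly_pCons sint)
  qed (simp add: ipoly_simps s0)
qed

text \<open>The images of numerator and denominator are forced, the latter being nonzero by
  injectivity; outside the field both functions are \<open>undefined\<close>.\<close>

lemma cyclo_aut_unique:
  assumes "is_cyclo_aut m t s" "is_cyclo_aut m t s'"
  shows "s = s'"
proof (rule extensionalityI)
  note s = assms[unfolded is_cyclo_aut_iff]
  show "s \<in> extensional (cyclo m)" "s' \<in> extensional (cyclo m)" using s by auto
  fix x assume "x \<in> cyclo m"
  then obtain g h where x: "x = ipoly g (zeta m) / ipoly h (zeta m)" and h: "ipoly h (zeta m) \<noteq> 0"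
    unfolding cyclo_eq by blast
  then have xh: "x * ipoly h (zeta m) = ipoly g (zeta m)" by simp
  have eq: "f x * ipoly h (zeta m powi t) = ipoly g (zeta m powi t) \<and> ipoly h (zeta m powi t) \<noteq> 0"
    if f: "is_cyclo_aut m t f" for f
  proof -
    note f' = f[unfolded is_cyclo_aut_iff]
    have "f (x * ipoly h (zeta m)) = f x * f (ipoly h (zeta m))"
      using f' \<open>x \<in> cyclo m\<close> ipoly_in_cyclo by blast
    moreover have "f 0 = 0" using cyclo_aut_ipoly[OF f, of 0] by (simp add: ipoly_simps)
    then have "f (ipoly h (zeta m)) \<noteq> 0"
      using f' h ipoly_in_cyclo cyclo_closed(1) unfolding bij_betw_def inj_on_def by metis
    ultimately show ?thesis unfolding xh by (simp add: cyclo_aut_ipoly[OF f])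
  qed
  from eq[OF assms(1)] eq[OF assms(2)] show "s x = s' x" by (metis mult_cancel_right)
qed

text \<open>The map replaces \<open>zeta m\<close> by \<open>zeta m ^ k\<close> in a fraction. It is
  well defined and injective because an integer polynomial vanishes at both points or at
  neither.\<close>

lemma ex_cyclo_aut:
  assumes m: "m > 0" and k: "coprime k m"
  shows "\<exists>s. is_cyclo_aut m (int k) s"
proof -
  define e where "e = (\<lambda>g. ipoly g (zeta m))"
  define e' where "e' = (\<lambda>g. ipoly g (zeta m ^ k))"
  have z: "e' g = 0 \<longleftrightarrow> e g = 0" for g unfolding e_def e'_def by (rule ipoly_conjugate_iff[OF m k])
  have C: "cyclo m = {e g / e h | g h. e h \<noteq> 0}" unfolding cyclo_eq e_def ..
  \<comment> \<open>Equality of two fractions is the vanishing of the cross-multiplied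
    difference.\<close>
  have frac: "e g / e h = e g' / e h' \<longleftrightarrow> e' g / e' h = e' g' / e' h'" if "e h \<noteq> 0" "e h' \<noteq> 0" for g h g' h'
    using z[of "g * h' - g' * h"] z[of h] z[of h'] that
    by (simp add: frac_eq_eq) (simp add: e_def e'_def ipoly_simps)
  define s where "s = restrict (\<lambda>x. THE w. \<exists>g h. e h \<noteq> 0 \<and> x = e g / e h \<and> w = e' g / e' h) (cyclo m)"
  have s: "s (e g / e h) = e' g / e' h" if h: "e h \<noteq> 0" for g h
  proof -
    have "(THE w. \<exists>g' h'. e h' \<noteq> 0 \<and> e g / e h = e g' / e h' \<and> w = e' g' / e' h') = e' g / e' h"
    proof (rule the_equality)
      show "\<exists>g' h'. e h' \<noteq> 0 \<and> e g / e h = e g' / e h' \<and> e' g / e' h = e' g' / e' h'" using h by blast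
    next
      fix w assume "\<exists>g' h'. e h' \<noteq> 0 \<and> e g / e h = e g' / e h' \<and> w = e' g' / e' h'"
      then obtain g' h' where "e h' \<noteq> 0" "e g / e h = e g' / e h'" "w = e' g' / e' h'" by blast
      then show "w = e' g / e' h" using frac[OF h, of h' g g'] by simp
    qed
    moreover have "e g / e h \<in> cyclo m" using h unfolding C by blast
    ultimately show ?thesis by (simp add: s_def)
  qed
  have s_poly: "s (e g) = e' g" for g
    using s[of 1 g] by (simp add: e_def e'_def ipoly_simps)
  obtain l where l: "[k * l = 1] (mod m)" using k by (metis cong_solve_coprime_nat One_nat_def)
  then have "coprime (k * l) m" by (metis cong_imp_coprime cong_sym coprime_1_left)
  then have lm: "coprime l m" by simp
  have "inj_on s (cyclo m)"
  proof (rule inj_onI)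
    fix x y assume "x \<in> cyclo m" "y \<in> cyclo m" "s x = s y"
    moreover from this obtain g h g' h' where "x = e g / e h" "e h \<noteq> 0" "y = e g' / e h'" "e h' \<noteq> 0"
      unfolding C by blast
    ultimately show "x = y" using frac s by metis
  qed
  moreover have "s ` cyclo m \<subseteq> cyclo m"
  proof clarify
    fix x assume "x \<in> cyclo m"
    then obtain g h where x: "x = e g / e h" "e h \<noteq> 0" unfolding C by blast
    have "s x = e (subst_power g k) / e (subst_power h k)"
      using s x by (simp add: e_def e'_def ipoly_subst_power)
    moreover have "e (subst_power h k) \<noteq> 0" using x z[of h] by (simp add: e_def e'_def ipoly_subst_power)
    ultimately show "s x \<in> cyclo m" unfolding C by blast
  qed
  moreover have "cyclo m \<subseteq> s ` cyclo m"
  proof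
    fix x assume "x \<in> cyclo m"
    then obtain g h where x: "x = e g / e h" "e h \<noteq> 0" unfolding C by blast
    \<comment> \<open>Substituting the power \<open>l\<close>, inverse to \<open>k\<close> modulo
      \<open>m\<close>, produces preimages.\<close>
    have e'e: "e' (subst_power p l) = e p" for p
    proof -
      have "(zeta m ^ k) ^ l = zeta m" using zeta_power_cong[OF m l] by (simp add: power_mult)
      then show ?thesis by (simp add: e_def e'_def ipoly_subst_power)
    qed
    have h: "e (subst_power h l) \<noteq> 0" using x(2) e'e z by metis
    have "s (e (subst_power g l) / e (subst_power h l)) = x" unfolding s[OF h] e'e x ..
    moreover have "e (subst_power g l) / e (subst_power h l) \<in> cyclo m" using h unfolding C by blast
    ultimately show "x \<in> s ` cyclo m" by blast
  qed
  ultimately have bij: "bij_betw s (cyclo m) (cyclo m)" by (auto simp: bij_betw_def)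
  have hom: "s (x + y) = s x + s y \<and> s (x * y) = s x * s y" if C': "x \<in> cyclo m" "y \<in> cyclo m" for x y
  proof -
    obtain g h g' h' where xy: "x = e g / e h" "e h \<noteq> 0" "y = e g' / e h'" "e h' \<noteq> 0"
      using C' unfolding C by blast
    have hh: "e (h * h') \<noteq> 0" using xy by (simp add: e_def ipoly_simps)
    have "x + y = e (g * h' + g' * h) / e (h * h')" "x * y = e (g * g') / e (h * h')"
      using xy by (simp_all add: e_def ipoly_simps add_frac_eq)
    moreover have "e' h \<noteq> 0" "e' h' \<noteq> 0" using xy z by auto
    ultimately show ?thesis
      using xy by (simp add: s[OF hh] s) (simp add: e'_def ipoly_simps add_frac_eq)
  qed
  have "s 1 = 1" using s_poly[of 1] by (simp add: e_def e'_def ipoly_simps)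
  moreover have "s (zeta m) = zeta m powi int k"
    using s_poly[of "Polynomial.monom 1 1"] by (simp add: e_def e'_def ipoly_monom)
  moreover have "s \<in> extensional (cyclo m)" by (simp add: s_def)
  ultimately have "is_cyclo_aut m (int k) s" unfolding is_cyclo_aut_iff using bij hom by blast
  then show ?thesis by blast
qed

section \<open>The action on the discriminants\<close>

lemma diff_poly_galois:
  assumes "N > 0" "m > 0" "coprime k m" "x \<in> points m N"
  shows "ipoly (diff_poly m (underlying x)) (zeta m ^ k) =
    complex_of_real (r m N (act m N (int k mod int m) x))"
proof -
  let ?t = "int k mod int m"
  have t: "coprime ?t (int m)" using assms(2,3) by simp
  note a = act[OF assms(1,2) t assms(4)]
  have "underlying x \<in> zero_subsets m N"
    using bij_betwE[OF bij_betw_underlying[OF assms(1,2)]] assms(4) by blast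
  then have S: "underlying x \<subseteq> {0..int m - 1}" by (simp add: zero_subsets_def residue_ring_carrier)
  have "ipoly (diff_poly m (underlying x)) (zeta m ^ k) = diff_prod m (underlying x) (int k)"
    by (rule ipoly_diff_poly[OF assms(2)])
  also have "\<dots> = diff_prod m (underlying x) ?t"
    by (rule diff_prod_cong[OF assms(2)]) simp
  also have "\<dots> = diff_prod m (underlying (act m N ?t x)) 1"
    unfolding a(2) by (rule diff_prod_mult_set[OF assms(2) t S, symmetric])
  also have "\<dots> = complex_of_real (r m N (act m N ?t x))"
    by (rule r_conv_diff_prod[OF assms(1) a(1), symmetric])
  finally show ?thesis .
qed

lemma r_conv_ipoly:
  assumes "N > 0" "m > 0" "x \<in> points m N"
  shows "complex_of_real (r m N x) = ipoly (diff_poly m (underlying x)) (zeta m)"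
  using ipoly_diff_poly[OF assms(2), of "underlying x" 1] r_conv_diff_prod[OF assms(1,3)] by simp

text \<open>Since \<open>m - k\<close> is \<open>-k\<close> modulo \<open>m\<close>, this is
  invariance under complex conjugation, the source of the factor 2 in the degree bound.\<close>

lemma diff_poly_conjugate:
  assumes "m > 0" "k < m"
  shows "ipoly (diff_poly m S) (zeta m ^ (m - k)) = ipoly (diff_poly m S) (zeta m ^ k)"
proof -
  have "diff_prod m S (int (m - k)) = diff_prod m S (- int k)"
    using assms by (intro diff_prod_cong) (auto simp: cong_iff_dvd_diff of_nat_diff)
  then show ?thesis by (simp add: ipoly_diff_poly[OF assms(1)] diff_prod_uminus)
qed

text \<open>Conjugating all roots permutes the points through \<open>act\<close>, so the product is
  invariant and the descent applies.\<close>

lemma D_int_poly: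
  assumes "N > 0" "m > 0"
  obtains P :: "int poly" where "map_poly of_int P = D m N"
proof -
  have eq: "(\<Prod>x\<in>points m N. [:- ipoly (diff_poly m (underlying x)) (zeta m ^ k), 1:]) = D m N"
    if k: "coprime k m" for k
  proof -
    have t: "coprime (int k mod int m) (int m)" using assms(2) k by simp
    have "(\<Prod>x\<in>points m N. [:- ipoly (diff_poly m (underlying x)) (zeta m ^ k), 1:])
       = (\<Prod>x\<in>points m N. [:- complex_of_real (r m N (act m N (int k mod int m) x)), 1:])"
      by (intro prod.cong refl) (simp add: diff_poly_galois[OF assms k])
    also have "\<dots> = D m N"
      unfolding D_def by (rule prod.reindex_bij_betw[OF bij_betw_act[OF assms t]])
    finally show ?thesis .
  qed
  obtain P where "map_poly of_int P =
      (\<Prod>x\<in>points m N. [:- ipoly (diff_poly m (underlying x)) (zeta m), 1:])"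
    using galois_invariant_prod_imp_int_poly[OF assms(2) finite_points[OF assms], of "\<lambda>x. diff_poly m (underlying x)"]
      eq eq[of 1] by auto
  then show ?thesis using that eq[of 1] by simp
qed

lemma root_D_iff:
  assumes "N > 0" "m > 0"
  shows "poly (D m N) z = 0 \<longleftrightarrow> (\<exists>x\<in>points m N. z = complex_of_real (r m N x))"
  using finite_points[OF assms] by (auto simp: D_def poly_prod)

text \<open>Integrality of the complex polynomial \<open>D\<close> is expressed by an integer
  preimage \<open>P\<close>, whose image over the rationals carries the factors. Since
  \<open>m > 2\<close>, \<open>totient m\<close> is even and \<open>div 2\<close> is exact.\<close>

theorem lemma5p1:
  fixes N m :: nat
  assumes "N \<ge> 2" and "m > N"
  shows
    "(\<forall>t\<in>Units (residue_ring (int m)).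
        (\<exists>!s. is_cyclo_aut m t s) \<and>
        bij_betw (mult_set m t) (zero_subsets m N) (zero_subsets m N) \<and>
        (\<forall>x\<in>points m N. \<exists>!y. y \<in> points m N \<and> underlying y = mult_set m t (underlying x)) \<and>
        bij_betw (act m N t) (points m N) (points m N) \<and>
        (\<forall>x\<in>points m N. complex_of_real (r m N x) \<in> cyclo m \<and>
           complex_of_real (r m N (act m N t x)) = cyclo_aut m t (complex_of_real (r m N x)))) \<and>
     (\<forall>z. poly (D m N) z = 0 \<longrightarrow> z \<in> cyclo_real m) \<and>
     (\<exists>P :: int poly. map_poly of_int P = D m N \<and>
        (\<forall>q :: rat poly. Factorial_Ring.irreducible q \<and> q dvd map_poly of_int P \<longrightarrow>
           Polynomial.degree q dvd totient m div 2))"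
proof (intro conjI)
  have N: "N > 0" and m: "m > 0" and m1: "m > 1" and m2: "m > 2" using assms by auto
  have r_cyclo: "complex_of_real (r m N x) \<in> cyclo m" if "x \<in> points m N" for x
    unfolding r_conv_ipoly[OF N m that] by (rule ipoly_in_cyclo)
  show "\<forall>t\<in>Units (residue_ring (int m)).
        (\<exists>!s. is_cyclo_aut m t s) \<and>
        bij_betw (mult_set m t) (zero_subsets m N) (zero_subsets m N) \<and>
        (\<forall>x\<in>points m N. \<exists>!y. y \<in> points m N \<and> underlying y = mult_set m t (underlying x)) \<and>
        bij_betw (act m N t) (points m N) (points m N) \<and>
        (\<forall>x\<in>points m N. complex_of_real (r m N x) \<in> cyclo m \<and>
           complex_of_real (r m N (act m N t x)) = cyclo_aut m t (complex_of_real (r m N x)))"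
  proof
    fix t assume "t \<in> Units (residue_ring (int m))"
    then have t: "0 < t" "t < int m" "coprime t (int m)" using Units_residue_ring[OF m1] by auto
    define k where "k = nat t"
    have tk: "t = int k" using t by (simp add: k_def)
    have k: "coprime k m" using t by (simp add: tk)
    have ex1: "\<exists>!s. is_cyclo_aut m t s"
      using ex_cyclo_aut[OF m k] cyclo_aut_unique unfolding tk by blast
    have aut: "is_cyclo_aut m t (cyclo_aut m t)"
      unfolding cyclo_aut_def by (rule theI'[OF ex1])
    have "complex_of_real (r m N (act m N t x)) = cyclo_aut m t (complex_of_real (r m N x))"
      if x: "x \<in> points m N" for x
    proof -
      have "cyclo_aut m t (complex_of_real (r m N x)) = ipoly (diff_poly m (underlying x)) (zeta m ^ k)"
        unfolding r_conv_ipoly[OF N m x] cyclo_aut_ipoly[OF aut] by (simp add: tk)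
      also have "\<dots> = complex_of_real (r m N (act m N t x))"
        using diff_poly_galois[OF N m k x] t by (simp add: tk[symmetric])
      finally show ?thesis ..
    qed
    then show "(\<exists>!s. is_cyclo_aut m t s) \<and>
        bij_betw (mult_set m t) (zero_subsets m N) (zero_subsets m N) \<and>
        (\<forall>x\<in>points m N. \<exists>!y. y \<in> points m N \<and> underlying y = mult_set m t (underlying x)) \<and>
        bij_betw (act m N t) (points m N) (points m N) \<and>
        (\<forall>x\<in>points m N. complex_of_real (r m N x) \<in> cyclo m \<and>
           complex_of_real (r m N (act m N t x)) = cyclo_aut m t (complex_of_real (r m N x)))"
      using ex1 bij_betw_mult_set[OF m t(3)] ex1_act[OF N m t(3)] bij_betw_act[OF N m t(3)] r_cyclo
      by blast
  qed
  show "\<forall>z. poly (D m N) z = 0 \<longrightarrow> z \<in> cyclo_real m"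
    using r_cyclo by (auto simp: root_D_iff[OF N m] cyclo_real_def)
  obtain P where P: "map_poly of_int P = D m N" by (rule D_int_poly[OF N m])
  have "Polynomial.degree q dvd totient m div 2"
    if q: "Factorial_Ring.irreducible q" "q dvd map_poly of_int P" for q :: "rat poly"
  proof -
    define Q where "Q = (map_poly of_rat q :: complex poly)"
    \<comment> \<open>A nonunit over a field is nonconstant or zero, so irreducibility gives a
      complex root; it is a root of \<open>D\<close> and hence one of the discriminants.\<close>
    have "Polynomial.degree q \<noteq> 0"
      using q(1) is_unit_iff_degree[of q] by (auto simp: Factorial_Ring.irreducible_def)
    then have "\<not> constant (poly Q)"
      by (simp add: constant_degree Q_def degree_map_poly)
    then obtain z where z: "poly Q z = 0" using fundamental_theorem_of_algebra by blast
    obtain h where h: "map_poly of_int P = q * h" using q(2) by (auto elim: dvdE)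
    have "D m N = map_poly of_rat (map_poly of_int P)"
      unfolding P[symmetric] by (simp add: map_poly_map_poly o_def)
    also have "\<dots> = Q * map_poly of_rat h"
      unfolding h Q_def by (rule of_rat_poly_hom.hom_mult)
    finally have "poly (D m N) z = 0" using z by simp
    then obtain x where x: "x \<in> points m N" "z = ipoly (diff_poly m (underlying x)) (zeta m)"
      using root_D_iff[OF N m] r_conv_ipoly[OF N m] by auto
    then show ?thesis
      using irreducible_degree_dvd_half_totient[OF m2 q(1), of "diff_poly m (underlying x)"]
        z diff_poly_conjugate[OF m] by (simp add: Q_def)
  qed
  then show "\<exists>P :: int poly. map_poly of_int P = D m N \<and>
        (\<forall>q :: rat poly. Factorial_Ring.irreducible q \<and> q dvd map_poly of_int P \<longrightarrow>
           Polynomial.degree q dvd totient m div 2)"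
    using P by blast
qed

end
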